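(* Let $E$ and $F$ be Banach spaces and $n\ge1$. If $E$ is reflexive and $\mathcal P_w(^nE,F)$ is an $M$-ideal in $\mathcal P(^nE,F)$, then $$R\big(B_{\mathcal P_w(^nE,F)}\big)=NA(\mathcal P(^nE,F)),$$ and thus $\mathcal P(^nE,F)\setminus R\big(B_{\mathcal P_w(^nE,F)}\big)$ is nowhere dense in $\mathcal P(^nE,F)$. In particular, $B_{\mathcal P_w(^nE,F)}$ is almost remotal in $\mathcal P(^nE,F)$.
   Context: $\mathcal P(^nE,F)$ is the Banach space of continuous $n$-homogeneous polynomials $P:E\to F$ with norm $\|P\|=\sup_{\|x\|\le1}\|P(x)\|$. $\mathcal P_w(^nE,F)$ is the subspace of polynomials that are weakly continuous on bounded sets: $\|P(x_\alpha)-P(x)\|\to0$ for every bounded net $(x_\alpha)$ converging weakly to $x\in E$. $NA(\mathcal P(^nE,F))$ is the set of $P\in\mathcal P(^nE,F)$ with $\|P(x)\|=\|P\|$ for some $x\in B_E$. A closed subspace $J$ of a Banach space $X$ is an $M$-ideal if there is a linear projection $\pi$ on $X^*$ with kernel $J^\perp$ such that $\|x^*\|=\|\pi(x^* )\|+\|x^*-\pi(x^* )\|$ for all $x^*\in X^*$. For a subspace $J$ of a Banach space $X$ and $x\in X$, $\rho(x,B_J)=\sup\{\|x-y\|:y\in B_J\}$, and $R(B_J)=\{x\in X:\exists\,y\in B_J,\ \|x-y\|=\rho(x,B_J)\}$. $B_J$ is almost remotal in $X$ if $R(B_J)$ contains a dense $G_\delta$ subset of $X$. *)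

theory Defs
  imports "HOL-Analysis.Analysis" "HOL-Library.Function_Algebras"
begin

section \<open>Scalars\<close>

text \<open>
  The scalar field is \<^emph>\<open>either\<close> the reals \<^emph>\<open>or\<close> the complex numbers. The second disjunct says
  that the field is isometrically isomorphic to the complex numbers.
\<close>

class rc_field = real_normed_field +
  assumes real_or_complex:
    "(\<forall>z. \<exists>a. z = a *\<^sub>R 1) \<or>
     (\<exists>j. j * j = - 1 \<and>
        (\<forall>z. \<exists>a b. z = a *\<^sub>R 1 + b *\<^sub>R j \<and> norm z = sqrt (a\<^sup>2 + b\<^sup>2)))"

instance real :: rc_field
  by standard auto

instance complex :: rc_field
proof
  have "\<exists>a b. z = a *\<^sub>R 1 + b *\<^sub>R \<i> \<and> norm z = sqrt (a\<^sup>2 + b\<^sup>2)" for z :: complex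
    by (rule exI[of _ "Re z"], rule exI[of _ "Im z"]) (simp add: complex_eq_iff cmod_def)
  then show "(\<forall>z :: complex. \<exists>a. z = a *\<^sub>R 1) \<or>
     (\<exists>j :: complex. j * j = - 1 \<and>
        (\<forall>z. \<exists>a b. z = a *\<^sub>R 1 + b *\<^sub>R j \<and> norm z = sqrt (a\<^sup>2 + b\<^sup>2)))"
    by (intro disjI2 exI[of _ \<i>]) simp
qed

text \<open>
  A normed (Banach) space over the scalar field is a type of class \<^class>\<open>real_normed_vector\<close>
  (\<^class>\<open>banach\<close>) with a scalar multiplication that extends the real one and is compatible with the
  norm. For real scalars it is necessarily \<^const>\<open>scaleR\<close>; every complex Banach space arises from its
  underlying real Banach space in this way.
\<close>

locale normed_space_over = vector_space scale
  for scale :: "'k::rc_field \<Rightarrow> 'a::real_normed_vector \<Rightarrow> 'a" +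
  assumes scale_of_real: "scale (of_real r) x = r *\<^sub>R x"
    and norm_scale: "norm (scale c x) = norm c * norm x"

definition fscale :: "('k \<Rightarrow> 'a \<Rightarrow> 'a) \<Rightarrow> 'k \<Rightarrow> ('b \<Rightarrow> 'a) \<Rightarrow> 'b \<Rightarrow> 'a" where
  "fscale s c f = (\<lambda>x. s c (f x))"


section \<open>Normed spaces carried by sets\<close>

text \<open>
  Spaces of polynomials and of functionals are not types, so a normed space is given here by
  a scalar multiplication \<open>s\<close>, a carrier \<open>X\<close> and a norm \<open>N\<close>; addition is that of the
  ambient type, which for functions is pointwise.
\<close>

definition unit_ball :: "'v set \<Rightarrow> ('v \<Rightarrow> real) \<Rightarrow> 'v set" where
  "unit_ball X N = {x \<in> X. N x \<le> 1}"

text \<open>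
  The locale \<^locale>\<open>Metric_space\<close> asks for nonnegativity and symmetry on the whole type, but
  \<open>N\<close> is only meaningful on \<open>X\<close>; hence the default value 0 off \<open>X\<close>.
\<close>

definition norm_topology :: "'v::ab_group_add set \<Rightarrow> ('v \<Rightarrow> real) \<Rightarrow> 'v topology" where
  "norm_topology X N =
     Metric_space.mtopology X (\<lambda>x y. if x \<in> X \<and> y \<in> X then N (x - y) else 0)"

text \<open>
  A functional on \<open>X\<close> is extended by 0 outside \<open>X\<close>, so that functionals that agree on \<open>X\<close> are equal.
\<close>

definition dual :: "('k::rc_field \<Rightarrow> 'v::ab_group_add \<Rightarrow> 'v) \<Rightarrow> 'v set \<Rightarrow> ('v \<Rightarrow> real) \<Rightarrow> ('v \<Rightarrow> 'k) set"
  where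
  "dual s X N = {\<phi>. (\<forall>x\<in>X. \<forall>y\<in>X. \<phi> (x + y) = \<phi> x + \<phi> y) \<and>
                    (\<forall>c. \<forall>x\<in>X. \<phi> (s c x) = c * \<phi> x) \<and>
                    (\<exists>C. \<forall>x\<in>X. norm (\<phi> x) \<le> C * N x) \<and>
                    (\<forall>x. x \<notin> X \<longrightarrow> \<phi> x = 0)}"

definition dual_norm :: "'v set \<Rightarrow> ('v \<Rightarrow> real) \<Rightarrow> ('v \<Rightarrow> 'k::rc_field) \<Rightarrow> real" where
  "dual_norm X N \<phi> = (SUP x\<in>unit_ball X N. norm (\<phi> x))"

definition annihilator ::
  "('k::rc_field \<Rightarrow> 'v::ab_group_add \<Rightarrow> 'v) \<Rightarrow> 'v set \<Rightarrow> ('v \<Rightarrow> real) \<Rightarrow> 'v set \<Rightarrow> ('v \<Rightarrow> 'k) set" where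
  "annihilator s X N J = {\<phi> \<in> dual s X N. \<forall>x\<in>J. \<phi> x = 0}"

definition reflexive :: "('k::rc_field \<Rightarrow> 'a::real_normed_vector \<Rightarrow> 'a) \<Rightarrow> bool" where
  "reflexive s \<longleftrightarrow>
     (\<forall>\<Phi> \<in> dual (fscale (*)) (dual s UNIV norm) (dual_norm UNIV norm).
        \<exists>x. \<forall>\<phi> \<in> dual s UNIV norm. \<Phi> \<phi> = \<phi> x)"

definition linear_projection_on ::
  "('k \<Rightarrow> 'v::ab_group_add \<Rightarrow> 'v) \<Rightarrow> 'v set \<Rightarrow> ('v \<Rightarrow> 'v) \<Rightarrow> bool" where
  "linear_projection_on s X p \<longleftrightarrow>
     (\<forall>x\<in>X. p x \<in> X) \<and>
     (\<forall>x\<in>X. \<forall>y\<in>X. p (x + y) = p x + p y) \<and>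
     (\<forall>c. \<forall>x\<in>X. p (s c x) = s c (p x)) \<and>
     (\<forall>x\<in>X. p (p x) = p x)"

definition M_ideal ::
  "('k::rc_field \<Rightarrow> 'v::ab_group_add \<Rightarrow> 'v) \<Rightarrow> 'v set \<Rightarrow> ('v \<Rightarrow> real) \<Rightarrow> 'v set \<Rightarrow> bool" where
  "M_ideal s X N J \<longleftrightarrow>
     module.subspace s J \<and> closedin (norm_topology X N) J \<and>
     (\<exists>p. linear_projection_on (fscale (*)) (dual s X N) p \<and>
          {\<phi> \<in> dual s X N. p \<phi> = 0} = annihilator s X N J \<and>
          (\<forall>\<phi> \<in> dual s X N. dual_norm X N \<phi> = dual_norm X N (p \<phi>) + dual_norm X N (\<phi> - p \<phi>)))"

definition farthest_dist :: "('v::ab_group_add \<Rightarrow> real) \<Rightarrow> 'v \<Rightarrow> 'v set \<Rightarrow> real" where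
  "farthest_dist N x B = (SUP y\<in>B. N (x - y))"

definition farthest_set :: "'v::ab_group_add set \<Rightarrow> ('v \<Rightarrow> real) \<Rightarrow> 'v set \<Rightarrow> 'v set" where
  "farthest_set X N B = {x \<in> X. \<exists>y\<in>B. N (x - y) = farthest_dist N x B}"

definition almost_remotal :: "'v::ab_group_add set \<Rightarrow> ('v \<Rightarrow> real) \<Rightarrow> 'v set \<Rightarrow> bool" where
  "almost_remotal X N B \<longleftrightarrow>
     (\<exists>D \<subseteq> farthest_set X N B.
        gdelta_in (norm_topology X N) D \<and> norm_topology X N closure_of D = X)"

definition nowhere_dense_in :: "'v topology \<Rightarrow> 'v set \<Rightarrow> bool" where
  "nowhere_dense_in T S \<longleftrightarrow> S \<subseteq> topspace T \<and> T interior_of (T closure_of S) = {}"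


section \<open>Homogeneous polynomials\<close>

text \<open>
  An \<open>n\<close>-linear map takes a sequence of vectors, of which only the first \<open>n\<close> entries matter.
\<close>

definition multilinear ::
  "nat \<Rightarrow> ('k::rc_field \<Rightarrow> 'e::real_normed_vector \<Rightarrow> 'e) \<Rightarrow> ('k \<Rightarrow> 'f::real_normed_vector \<Rightarrow> 'f) \<Rightarrow>
    ((nat \<Rightarrow> 'e) \<Rightarrow> 'f) \<Rightarrow> bool" where
  "multilinear n sE sF A \<longleftrightarrow>
     (\<forall>v. \<forall>i<n. Vector_Spaces.linear sE sF (\<lambda>x. A (v(i := x)))) \<and>
     (\<forall>v w. (\<forall>i<n. v i = w i) \<longrightarrow> A v = A w)"

definition hpoly ::
  "nat \<Rightarrow> ('k::rc_field \<Rightarrow> 'e::real_normed_vector \<Rightarrow> 'e) \<Rightarrow> ('k \<Rightarrow> 'f::real_normed_vector \<Rightarrow> 'f) \<Rightarrow>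
    ('e \<Rightarrow> 'f) set" where
  "hpoly n sE sF =
     {P. (\<exists>A. multilinear n sE sF A \<and> (\<forall>x. P x = A (\<lambda>_. x))) \<and> continuous_on UNIV P}"

definition poly_norm :: "('e::real_normed_vector \<Rightarrow> 'f::real_normed_vector) \<Rightarrow> real" where
  "poly_norm P = (SUP x\<in>cball 0 1. norm (P x))"

text \<open>
  Nets in \<open>E\<close> are represented by filters on \<open>E\<close>: a net gives the image of its section filter,
  and every filter arises from a net.
\<close>

definition weakly_converges ::
  "('k::rc_field \<Rightarrow> 'e::real_normed_vector \<Rightarrow> 'e) \<Rightarrow> 'e filter \<Rightarrow> 'e \<Rightarrow> bool" where
  "weakly_converges s G x \<longleftrightarrow> (\<forall>\<phi> \<in> dual s UNIV norm. (\<phi> \<longlongrightarrow> \<phi> x) G)"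

definition weakly_continuous_on_bounded ::
  "('k::rc_field \<Rightarrow> 'e::real_normed_vector \<Rightarrow> 'e) \<Rightarrow> ('e \<Rightarrow> 'f::real_normed_vector) \<Rightarrow> bool" where
  "weakly_continuous_on_bounded s P \<longleftrightarrow>
     (\<forall>G x. (\<exists>C. \<forall>\<^sub>F y in G. norm y \<le> C) \<and> weakly_converges s G x \<longrightarrow>
            ((\<lambda>y. norm (P y - P x)) \<longlongrightarrow> 0) G)"

definition hpoly_w ::
  "nat \<Rightarrow> ('k::rc_field \<Rightarrow> 'e::real_normed_vector \<Rightarrow> 'e) \<Rightarrow> ('k \<Rightarrow> 'f::real_normed_vector \<Rightarrow> 'f) \<Rightarrow>
    ('e \<Rightarrow> 'f) set" where
  "hpoly_w n sE sF = {P \<in> hpoly n sE sF. weakly_continuous_on_bounded sE P}"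

definition norm_attaining ::
  "nat \<Rightarrow> ('k::rc_field \<Rightarrow> 'e::real_normed_vector \<Rightarrow> 'e) \<Rightarrow> ('k \<Rightarrow> 'f::real_normed_vector \<Rightarrow> 'f) \<Rightarrow>
    ('e \<Rightarrow> 'f) set" where
  "norm_attaining n sE sF = {P \<in> hpoly n sE sF. \<exists>x. norm x \<le> 1 \<and> norm (P x) = poly_norm P}"

end

theory Submission
  imports Defs
begin

text \<open>
  Rank-one polynomials \<open>\<alpha>\<^sup>n \<cdot> w\<close> show that the farthest distance from \<open>P\<close> to the ball is \<open>\<parallel>P\<parallel> + 1\<close>
  and that it is realised when \<open>P\<close> attains its norm. For the converse, take a limit \<open>\<phi>\<close> along an
  ultrafilter of evaluations \<open>S \<mapsto> y\<^sub>m (S x\<^sub>m)\<close> norming \<open>P - Q\<close>, where \<open>Q\<close> is a farthest point. By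
  reflexivity and weak continuity, \<open>\<phi>\<close> agrees on the \<open>M\<close>-ideal with an evaluation
  \<open>\<psi>: S \<mapsto> y\<^sub>0 (S x\<^sub>0)\<close> of norm at most \<open>1\<close>. Since \<open>|\<phi> Q| = 1\<close>, the restriction of \<open>\<phi>\<close> has full norm, so
  uniqueness of norm-preserving extensions from \<open>M\<close>-ideals gives \<open>\<phi> = \<psi>\<close>, and \<open>P\<close> attains its norm at
  \<open>x\<^sub>0\<close>. The same argument applies to \<open>P\<close> itself when its distance to the \<open>M\<close>-ideal is less than
  \<open>\<parallel>P\<parallel>\<close>. Such polynomials form an open set, which is dense because subtracting \<open>t Q\<close> with suitable
  \<open>Q\<close> in the unit ball of the \<open>M\<close>-ideal increases the norm almost by \<open>t\<close> without changing the distance.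
\<close>

section \<open>Norming functionals\<close>

definition sublinear :: "('a::real_vector \<Rightarrow> real) \<Rightarrow> bool" where
  "sublinear q \<longleftrightarrow> (\<forall>x y. q (x + y) \<le> q x + q y) \<and> (\<forall>t\<ge>0. \<forall>x. q (t *\<^sub>R x) \<le> t * q x)"

lemma sublinear_add: "sublinear q \<Longrightarrow> q (x + y) \<le> q x + q y"
  and sublinear_scale_le: "sublinear q \<Longrightarrow> t \<ge> 0 \<Longrightarrow> q (t *\<^sub>R x) \<le> t * q x"
  by (auto simp: sublinear_def)

lemma sublinear_scale:
  assumes q: "sublinear q" and "t > 0"
  shows "q (t *\<^sub>R x) = t * q x"
proof (rule antisym)
  have "q x \<le> inverse t * q (t *\<^sub>R x)"
    using sublinear_scale_le[OF q, of "inverse t" "t *\<^sub>R x"] \<open>t > 0\<close> by simp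
  then show "t * q x \<le> q (t *\<^sub>R x)"
    using \<open>t > 0\<close> by (simp add: field_simps)
qed (use assms sublinear_scale_le in force)

lemma sublinear_zero [simp]: "sublinear q \<Longrightarrow> q 0 = 0"
  using sublinear_add[of q 0 0] sublinear_scale_le[of q 0 0] by simp

lemma sublinear_minus: "sublinear q \<Longrightarrow> - q (- x) \<le> q x"
  using sublinear_add[of q x "- x"] by simp

lemma sublinear_norm: "sublinear norm"
  by (simp add: sublinear_def norm_triangle_ineq)

text \<open>The witness is the pointwise infimum. It is finite because \<open>q x\<close> is at
  least \<open>- q (- x)\<close>, hence at least \<open>- p (- x)\<close>. Subadditivity uses the
  chain: given \<open>q\<close> at \<open>x\<close> and \<open>r\<close> at \<open>y\<close>, the
  smaller of the two functionals bounds \<open>u (x + y)\<close> by its values at both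
  points.\<close>

lemma sublinear_Inf_chain:
  assumes C: "C \<noteq> {}" "\<And>q. q \<in> C \<Longrightarrow> sublinear q \<and> q \<le> p"
    and chain: "\<And>q r. q \<in> C \<Longrightarrow> r \<in> C \<Longrightarrow> q \<le> r \<or> r \<le> q"
  shows "\<exists>u. sublinear u \<and> u \<le> p \<and> (\<forall>q\<in>C. u \<le> q)"
proof -
  define u where "u = (\<lambda>x. INF q\<in>C. q x)"
  have bdd: "bdd_below ((\<lambda>q. q x) ` C)" for x
  proof (rule bdd_belowI2[where m = "- p (- x)"])
    fix q assume "q \<in> C"
    then have "- q (- x) \<le> q x" "q (- x) \<le> p (- x)"
      using C(2) sublinear_minus by (auto simp: le_fun_def)
    then show "- p (- x) \<le> q x" by linarith
  qed
  have u_le: "u x \<le> q x" if "q \<in> C" for q x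
    unfolding u_def using bdd that by (rule cINF_lower)
  have le_u: "b \<le> u x" if "\<And>q. q \<in> C \<Longrightarrow> b \<le> q x" for b x
    unfolding u_def using C(1) that by (rule cINF_greatest)
  have "u (x + y) \<le> u x + u y" for x y
  proof -
    have "u (x + y) - q x \<le> r y" if q: "q \<in> C" and r: "r \<in> C" for q r
      using chain[OF q r]
    proof
      assume "q \<le> r"
      then have "u (x + y) \<le> q x + q y" "q y \<le> r y"
        using u_le[OF q, of "x + y"] sublinear_add[of q x y] C(2)[OF q] by (auto simp: le_fun_def)
      then show ?thesis by linarith
    next
      assume "r \<le> q"
      then have "u (x + y) \<le> r x + r y" "r x \<le> q x"
        using u_le[OF r, of "x + y"] sublinear_add[of r x y] C(2)[OF r] by (auto simp: le_fun_def)
      then show ?thesis by linarith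
    qed
    then have "u (x + y) - q x \<le> u y" if "q \<in> C" for q
      using that by (blast intro: le_u)
    then have "u (x + y) - u y \<le> u x"
      by (intro le_u) (simp add: algebra_simps)
    then show ?thesis by simp
  qed
  moreover have "u (t *\<^sub>R x) \<le> t * u x" if "t \<ge> 0" for t x
  proof (cases "t = 0")
    case True
    obtain q where "q \<in> C" using C(1) by blast
    then show ?thesis using u_le[of q 0] C(2)[of q] True by simp
  next
    case False
    then have "u (t *\<^sub>R x) / t \<le> q x" if "q \<in> C" for q
      using u_le[OF that, of "t *\<^sub>R x"] sublinear_scale_le[of q t x] C(2)[OF that] \<open>t \<ge> 0\<close>
      by (simp add: field_simps)
    then have "u (t *\<^sub>R x) / t \<le> u x" by (rule le_u)
    then show ?thesis using False \<open>t \<ge> 0\<close> by (simp add: field_simps)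
  qed
  moreover have "u \<le> p"
    using C u_le by (metis all_not_in_conv le_fun_def order_trans)
  ultimately show ?thesis
    using u_le by (intro exI[of _ u]) (auto simp: sublinear_def le_fun_def)
qed

text \<open>The witness is the infimum over t \<ge> 0 of
  \<open>q (z + t *\<^sub>R y) - t * q y\<close>. The choice t = 0 gives the domination by
  \<open>q\<close>, and t = 1 at \<open>- y\<close> gives the last inequality. The lemma is used to
  show that minimal functionals are odd, and to prescribe the value of a linear functional at one
  vector.\<close>

lemma sublinear_lower_at:
  assumes q: "sublinear q"
  shows "\<exists>r. sublinear r \<and> r \<le> q \<and> r (- y) \<le> - q y"
proof -
  define Q where "Q z t = q (z + t *\<^sub>R y) - t * q y" for z t
  define r where "r = (\<lambda>z. INF t\<in>{0..}. Q z t)"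
  have scale: "q (t *\<^sub>R x) = t * q x" if "t \<ge> 0" for t x
    using sublinear_scale[OF q] sublinear_zero[OF q] that by (cases "t = 0") auto
  have bdd: "bdd_below (Q z ` {0..})" for z
  proof (rule bdd_belowI2[where m = "- q (- z)"])
    \<comment> \<open>Subadditivity applied to t y = (z + t y) + (- z), together with homogeneity,
      gives a bound that does not depend on t.\<close>
    fix t :: real assume "t \<in> {0..}"
    then show "- q (- z) \<le> Q z t"
      using sublinear_add[OF q, of "z + t *\<^sub>R y" "- z"] scale[of t y] by (simp add: Q_def)
  qed
  have r_le: "r z \<le> Q z t" if "t \<ge> 0" for z t
    unfolding r_def using bdd that by (auto intro: cINF_lower)
  have le_r: "b \<le> r z" if "\<And>t. t \<ge> 0 \<Longrightarrow> b \<le> Q z t" for b z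
    unfolding r_def using that by (auto intro!: cINF_greatest)
  have "r (z + w) \<le> r z + r w" for z w
  proof -
    have "r (z + w) - Q z s \<le> Q w t" if "s \<ge> 0" "t \<ge> 0" for s t
      using r_le[of "s + t" "z + w"] sublinear_add[OF q, of "z + s *\<^sub>R y" "w + t *\<^sub>R y"] that
      by (simp add: Q_def algebra_simps)
    then have "r (z + w) - Q z s \<le> r w" if "s \<ge> 0" for s
      using that by (blast intro: le_r)
    then have "r (z + w) - r w \<le> r z"
      by (intro le_r) (simp add: algebra_simps)
    then show ?thesis by simp
  qed
  moreover have "r (c *\<^sub>R z) \<le> c * r z" if "c \<ge> 0" for c z
  proof (cases "c = 0")
    case True
    then show ?thesis using r_le[of 0 0] q by (simp add: Q_def)
  next
    case False
    have "r (c *\<^sub>R z) / c \<le> Q z t" if "t \<ge> 0" for t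
      using r_le[of "c * t" "c *\<^sub>R z"] scale[of c "z + t *\<^sub>R y"] False that \<open>c \<ge> 0\<close>
      by (simp add: Q_def field_simps scaleR_add_right)
    then have "r (c *\<^sub>R z) / c \<le> r z" by (rule le_r)
    then show ?thesis using False \<open>c \<ge> 0\<close> by (simp add: field_simps)
  qed
  moreover have "r z \<le> q z" for z
    using r_le[of 0 z] by (simp add: Q_def)
  moreover have "r (- y) \<le> - q y"
    using r_le[of 1 "- y"] q by (simp add: Q_def)
  ultimately show ?thesis
    by (intro exI[of _ r]) (auto simp: sublinear_def le_fun_def)
qed

text \<open>
  A minimal sublinear functional is odd by \<open>sublinear_lower_at\<close>, and an odd subadditive functional is
  additive. No extension of functionals from subspaces is involved.
\<close>

lemma sublinear_dominates_linear:
  assumes p: "sublinear p"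
  shows "\<exists>f. linear f \<and> f \<le> p"
proof -
  define S where "S = {q. sublinear q \<and> q \<le> p}"
  \<comment> \<open>Zorn's lemma is applied to the reversed order, so that its maximal element is a
    minimal sublinear functional.\<close>
  have "\<exists>m\<in>S. \<forall>q\<in>S. q \<le> m \<longrightarrow> q = m"
  proof (rule predicate_Zorn[where P = "\<lambda>a b. b \<le> a"])
    show "partial_order_on S (relation_of (\<lambda>a b. b \<le> a) S)"
      by (rule partial_order_on_relation_ofI) auto
  next
    fix C assume C: "C \<in> Chains (relation_of (\<lambda>a b. b \<le> a) S)"
    show "\<exists>u\<in>S. \<forall>a\<in>C. u \<le> a"
    proof (cases "C = {}")
      case True
      then show ?thesis using p by (auto simp: S_def)
    next
      case False
      have "\<exists>u. sublinear u \<and> u \<le> p \<and> (\<forall>q\<in>C. u \<le> q)"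
        using C by (intro sublinear_Inf_chain[OF False])
          (auto simp: Chains_def relation_of_def S_def)
      then show ?thesis by (auto simp: S_def)
    qed
  qed
  then obtain m where m: "sublinear m" "m \<le> p"
    and min: "\<And>q. sublinear q \<Longrightarrow> q \<le> m \<Longrightarrow> q = m"
    by (auto simp: S_def)
  have odd: "m (- y) = - m y" for y
  proof -
    obtain r where "sublinear r" "r \<le> m" "r (- y) \<le> - m y"
      using sublinear_lower_at[OF m(1)] by blast
    then have "m (- y) \<le> - m y" using min by blast
    then show ?thesis using sublinear_minus[OF m(1), of y] by linarith
  qed
  have "linear m"
  proof (rule linearI)
    fix x y
    show "m (x + y) = m x + m y"
      using sublinear_add[OF m(1), of x y] sublinear_add[OF m(1), of "x + y" "- y"] odd[of y]
      by simp
  next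
    fix c x
    show "m (c *\<^sub>R x) = c *\<^sub>R m x"
    proof (cases "c < 0")
      case True
      then show ?thesis
        using sublinear_scale[OF m(1), of "- c" x] odd[of "c *\<^sub>R x"] by simp
    next
      case False
      then show ?thesis
        using sublinear_scale[OF m(1), of c x] sublinear_zero[OF m(1)] by (cases "c = 0") auto
    qed
  qed
  then show ?thesis using m(2) by blast
qed

lemma real_norming_functional:
  fixes x :: "'a::real_normed_vector"
  shows "\<exists>f. linear f \<and> (\<forall>z. \<bar>f z\<bar> \<le> norm z) \<and> f x = norm x"
proof -
  \<comment> \<open>Passing from the norm to \<open>r\<close> first builds the value at
    \<open>x\<close> into the bound: every linear \<open>f\<close> below \<open>r\<close> has
    \<open>f (- x)\<close> at most \<open>- norm x\<close>, which forces
    \<open>f x = norm x\<close>.\<close>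
  obtain r where r: "sublinear r" "r \<le> norm" "r (- x) \<le> - norm x"
    using sublinear_lower_at[OF sublinear_norm] by blast
  obtain f where f: "linear f" "f \<le> r"
    using sublinear_dominates_linear[OF r(1)] by blast
  have le: "f z \<le> norm z" for z
    using f(2) r(2) by (metis le_fun_def order_trans)
  have abs: "\<bar>f z\<bar> \<le> norm z" for z
    using le[of z] le[of "- z"] linear_neg[OF f(1), of z] by simp
  moreover have "f (- x) \<le> - norm x"
    using f(2) r(3) by (metis le_fun_def order_trans)
  then have "f x = norm x"
    using le[of x] linear_neg[OF f(1), of x] by simp
  ultimately show ?thesis using f(1) by blast
qed

text \<open>For real scalars the real functional \<open>f\<close> is merely cast into the field. For
  complex scalars \<open>f\<close> is taken as the real part of \<phi>, and complex linearity then
  dictates the imaginary part \<open>- f (s j z)\<close>.\<close>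

lemma norming_functional:
  fixes s :: "'k::rc_field \<Rightarrow> 'a::real_normed_vector \<Rightarrow> 'a"
  assumes s: "normed_space_over s"
  shows "\<exists>\<phi>\<in>dual s UNIV norm. (\<forall>z. norm (\<phi> z) \<le> norm z) \<and> \<phi> x = of_real (norm x)"
proof -
  interpret normed_space_over s by (rule s)
  obtain f where f: "linear f" "\<And>z. \<bar>f z\<bar> \<le> norm z" "f x = norm x"
    using real_norming_functional by blast
  note f_add = linear_add[OF f(1)] and f_scale = linear_scale[OF f(1), simplified]
  have dualI: "\<phi> \<in> dual s UNIV norm"
    if "\<And>x y. \<phi> (x + y) = \<phi> x + \<phi> y" "\<And>c x. \<phi> (s c x) = c * \<phi> x"
      "\<And>z. norm (\<phi> z) \<le> norm z" for \<phi>
    unfolding dual_def using that by (auto intro!: exI[of _ 1])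
  show ?thesis
    using real_or_complex[where 'a = 'k]
  proof
    assume real: "\<forall>z::'k. \<exists>a. z = a *\<^sub>R 1"
    define \<phi> :: "'a \<Rightarrow> 'k" where "\<phi> z = of_real (f z)" for z
    have "\<phi> (s c z) = c * \<phi> z" for c z
    proof -
      obtain a where "c = of_real a" using real by (auto simp: of_real_def)
      then show ?thesis by (simp add: \<phi>_def scale_of_real f_scale)
    qed
    then have "\<phi> \<in> dual s UNIV norm"
      using f(2) by (intro dualI) (auto simp: \<phi>_def f_add)
    then show ?thesis
      using f(2,3) by (intro bexI[of _ \<phi>]) (auto simp: \<phi>_def)
  next
    assume "\<exists>j::'k. j * j = - 1 \<and> (\<forall>z. \<exists>a b. z = a *\<^sub>R 1 + b *\<^sub>R j \<and> norm z = sqrt (a\<^sup>2 + b\<^sup>2))"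
    then obtain j :: 'k where j: "j * j = - 1"
      and coord: "\<And>z::'k. \<exists>a b. z = of_real a + of_real b * j \<and> norm z = sqrt (a\<^sup>2 + b\<^sup>2)"
      by (auto simp: of_real_def)
    \<comment> \<open>The class asserts only that coordinates exist. Their uniqueness follows by
      squaring (b - d) j = c - a: since j squares to -1, a sum of two real squares vanishes.\<close>
    have indep: "a = c \<and> b = d" if "of_real a + of_real b * j = of_real c + of_real d * j" for a b c d
    proof -
      have *: "of_real (b - d) * j = of_real (c - a)"
        using that by (simp add: algebra_simps)
      then have "(of_real (b - d) * j) * (of_real (b - d) * j) = (of_real (c - a) * of_real (c - a) :: 'k)"
        by simp
      moreover have "(of_real (b - d) * j) * (of_real (b - d) * j)
          = of_real (b - d) * of_real (b - d) * (j * j)"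
        by (simp only: ac_simps)
      ultimately have "of_real (- ((b - d) * (b - d))) = (of_real ((c - a) * (c - a)) :: 'k)"
        using j by simp
      then have "(c - a) * (c - a) + (b - d) * (b - d) = 0"
        unfolding of_real_eq_iff by linarith
      then show ?thesis
        unfolding sum_squares_eq_zero_iff by linarith
    qed
    have norm_coord: "norm (of_real a + of_real b * j) = sqrt (a\<^sup>2 + b\<^sup>2)" for a b
      using coord[of "of_real a + of_real b * j"] indep by metis
    define \<phi> where "\<phi> z = of_real (f z) - of_real (f (s j z)) * j" for z
    have \<phi>_add: "\<phi> (y + z) = \<phi> y + \<phi> z" for y z
      by (simp add: \<phi>_def f_add scale_right_distrib algebra_simps)
    have \<phi>_real: "\<phi> (s (of_real a) z) = of_real a * \<phi> z" for a z
    proof -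
      have "s j (a *\<^sub>R z) = a *\<^sub>R s j z"
        using scale_left_commute[of j "of_real a" z] by (simp only: scale_of_real)
      then show ?thesis
        by (simp add: \<phi>_def scale_of_real f_scale algebra_simps)
    qed
    have \<phi>_j: "\<phi> (s j z) = j * \<phi> z" for z
    proof -
      have "s j (s j z) = - z" using j by simp
      moreover have "j * \<phi> z = of_real (f z) * j - of_real (f (s j z)) * (j * j)"
        by (simp add: \<phi>_def right_diff_distrib ac_simps)
      ultimately show ?thesis
        using j linear_neg[OF f(1), of z] by (simp add: \<phi>_def)
    qed
    have \<phi>_scale: "\<phi> (s c z) = c * \<phi> z" for c z
    proof -
      obtain a b where c: "c = of_real a + of_real b * j" using coord by blast
      have "s c z = s (of_real a) z + s (of_real b) (s j z)"
        by (simp add: c scale_left_distrib)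
      then show ?thesis
        by (simp only: c \<phi>_add \<phi>_real \<phi>_j distrib_right mult.assoc)
    qed
    have \<phi>_le: "norm (\<phi> z) \<le> norm z" for z
    proof (cases "\<phi> z = 0")
      case False
      \<comment> \<open>A rotation by the unimodular scalar \<open>c\<close> makes the value of
        \<phi> real and nonnegative. The value then equals its real part, which is controlled by
        \<open>f\<close>.\<close>
      define c where "c = of_real (norm (\<phi> z)) / \<phi> z"
      have "norm c = 1" using False by (simp add: c_def norm_divide)
      have "\<phi> (s c z) = of_real (norm (\<phi> z)) + of_real 0 * j"
        using False by (simp add: \<phi>_scale c_def)
      moreover have "\<phi> (s c z) = of_real (f (s c z)) + of_real (- f (s j (s c z))) * j"
        by (simp add: \<phi>_def)
      ultimately have "norm (\<phi> z) = f (s c z)" by (metis indep)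
      also have "\<dots> \<le> norm z" using f(2)[of "s c z"] \<open>norm c = 1\<close> by (simp add: norm_scale)
      finally show ?thesis .
    qed simp
    \<comment> \<open>The real part of \<open>\<phi> x\<close> already has modulus
      \<open>norm x\<close>, so the bound on \<phi> leaves no room for an imaginary part.\<close>
    have "norm (\<phi> x) = sqrt ((norm x)\<^sup>2 + (f (s j x))\<^sup>2)"
      using norm_coord[of "norm x" "- f (s j x)"] f(3) by (simp add: \<phi>_def)
    with \<phi>_le[of x] have "sqrt ((norm x)\<^sup>2 + (f (s j x))\<^sup>2) \<le> norm x" by simp
    then have "f (s j x) = 0"
      using sqrt_le_D by fastforce
    then have "\<phi> x = of_real (norm x)" by (simp add: \<phi>_def f(3))
    then show ?thesis
      using dualI[of \<phi>] \<phi>_add \<phi>_scale \<phi>_le by blast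
  qed
qed

section \<open>Limits along ultrafilters\<close>

text \<open>The ball is a closed subset of the image of a compact square under (a, b) \<mapsto> a +
  b j. Taking j = 0 for real scalars lets one argument serve both fields.\<close>

lemma compact_cball_rc_field: "compact (cball (0::'k::rc_field) C)"
proof -
  have "\<exists>j::'k. \<forall>z. \<exists>a b. z = a *\<^sub>R 1 + b *\<^sub>R j \<and> \<bar>a\<bar> \<le> norm z \<and> \<bar>b\<bar> \<le> norm z" (is ?coord)
    using real_or_complex[where 'a = 'k]
  proof
    assume real: "\<forall>z::'k. \<exists>a. z = a *\<^sub>R 1"
    show ?coord
    proof (rule exI[of _ 0], rule allI)
      fix z :: 'k
      obtain a where "z = a *\<^sub>R 1" using real by blast
      then show "\<exists>a b. z = a *\<^sub>R 1 + b *\<^sub>R 0 \<and> \<bar>a\<bar> \<le> norm z \<and> \<bar>b\<bar> \<le> norm z"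
        by (intro exI[of _ a] exI[of _ 0]) auto
    qed
  next
    assume "\<exists>j::'k. j * j = - 1 \<and> (\<forall>z. \<exists>a b. z = a *\<^sub>R 1 + b *\<^sub>R j \<and> norm z = sqrt (a\<^sup>2 + b\<^sup>2))"
    then obtain j :: 'k where "\<And>z. \<exists>a b. z = a *\<^sub>R 1 + b *\<^sub>R j \<and> norm z = sqrt (a\<^sup>2 + b\<^sup>2)"
      by blast
    moreover have "\<bar>a\<bar> \<le> sqrt (a\<^sup>2 + b\<^sup>2) \<and> \<bar>b\<bar> \<le> sqrt (a\<^sup>2 + b\<^sup>2)" for a b :: real
      by (auto intro: real_le_rsqrt)
    ultimately show ?coord by metis
  qed
  then obtain j :: 'k
    where coord: "\<And>z. \<exists>a b. z = a *\<^sub>R 1 + b *\<^sub>R j \<and> \<bar>a\<bar> \<le> norm z \<and> \<bar>b\<bar> \<le> norm z"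
    by blast
  define g :: "real \<times> real \<Rightarrow> 'k" where "g p = fst p *\<^sub>R 1 + snd p *\<^sub>R j" for p
  have "compact (g ` ({- C..C} \<times> {- C..C}))"
    unfolding g_def by (intro compact_continuous_image continuous_intros compact_Times compact_Icc)
  then have "compact (g ` ({- C..C} \<times> {- C..C}) \<inter> cball 0 C)"
    by (rule compact_Int_closed) simp
  moreover have "cball 0 C \<subseteq> g ` ({- C..C} \<times> {- C..C})"
  proof
    fix z :: 'k assume "z \<in> cball 0 C"
    moreover obtain a b where "z = a *\<^sub>R 1 + b *\<^sub>R j" "\<bar>a\<bar> \<le> norm z" "\<bar>b\<bar> \<le> norm z"
      using coord by blast
    ultimately show "z \<in> g ` ({- C..C} \<times> {- C..C})"
      by (intro image_eqI[of _ _ "(a, b)"]) (auto simp: g_def abs_le_iff)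
  qed
  ultimately show ?thesis by (simp add: Int_absorb1)
qed

text \<open>
  By Tychonoff, the sequence of evaluations at \<open>m\<close> of all bounded scalar sequences has a cluster
  point; the filter converging to it plays the role of a free ultrafilter.
\<close>

lemma subfilter_all_bounded_converge:
  shows "\<exists>G\<le>sequentially. G \<noteq> bot \<and> (\<forall>f::nat \<Rightarrow> 'k::rc_field. Bseq f \<longrightarrow> (\<exists>l. (f \<longlongrightarrow> l) G))"
proof -
  \<comment> \<open>The value 0 at unbounded sequences keeps every coordinate in a bounded set, so
    that all points \<Theta> m lie in one compact product of balls.\<close>
  define \<Theta> :: "nat \<Rightarrow> (nat \<Rightarrow> 'k) \<Rightarrow> 'k" where "\<Theta> m f = (if Bseq f then f m else 0)" for m f
  have "\<exists>C. \<forall>m. norm (\<Theta> m f) \<le> C" for f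
  proof (cases "Bseq f")
    case True
    then show ?thesis by (auto simp: \<Theta>_def elim!: BseqE)
  qed (auto simp: \<Theta>_def)
  then obtain C where C: "\<And>f m. norm (\<Theta> m f) \<le> C f" by metis
  have "compactin (product_topology (\<lambda>_. euclidean) UNIV) (\<Pi>\<^sub>E f\<in>UNIV. cball (0::'k) (C f))"
    unfolding compactin_PiE by (simp add: compactin_euclidean_iff compact_cball_rc_field)
  then have "compact (\<Pi>\<^sub>E f\<in>UNIV. cball (0::'k) (C f))"
    by (simp add: euclidean_product_topology)
  moreover have "filtermap \<Theta> sequentially \<noteq> bot"
    by (simp add: filtermap_bot_iff)
  moreover have "\<forall>\<^sub>F g in filtermap \<Theta> sequentially. g \<in> (\<Pi>\<^sub>E f\<in>UNIV. cball (0::'k) (C f))"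
    unfolding eventually_filtermap using C by (intro always_eventually) auto
  ultimately obtain g where g: "inf (nhds g) (filtermap \<Theta> sequentially) \<noteq> bot"
    unfolding compact_filter le_principal by blast
  \<comment> \<open>Pulling the neighbourhoods of the cluster point back along \<Theta> turns
    clustering into convergence along \<open>G\<close>; that \<open>G\<close> is proper is exactly
    the cluster property of \<open>g\<close>.\<close>
  define G where "G = inf sequentially (filtercomap \<Theta> (nhds g))"
  have "G \<noteq> bot"
  proof
    assume "G = bot"
    then have "eventually (\<lambda>_. False) G" by simp
    then obtain P Q where P: "eventually P sequentially"
      and Q: "eventually Q (filtercomap \<Theta> (nhds g))" and PQ: "\<And>m. P m \<Longrightarrow> Q m \<Longrightarrow> False"
      unfolding G_def eventually_inf by blast
    obtain R where R: "eventually R (nhds g)" "\<And>m. R (\<Theta> m) \<Longrightarrow> Q m"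
      using Q unfolding eventually_filtercomap by blast
    have "eventually (\<lambda>h. \<not> R h) (filtermap \<Theta> sequentially)"
      unfolding eventually_filtermap using P by (rule eventually_mono) (use PQ R(2) in blast)
    with R(1) have "eventually (\<lambda>_. False) (inf (nhds g) (filtermap \<Theta> sequentially))"
      unfolding eventually_inf by blast
    with g show False by (simp add: eventually_False)
  qed
  moreover have "(f \<longlongrightarrow> g f) G" if "Bseq f" for f
  proof -
    have "filterlim \<Theta> (nhds g) G"
      unfolding G_def by (rule filterlim_mono[OF filterlim_filtercomap order_refl]) simp
    then have "((\<lambda>m. \<Theta> m f) \<longlongrightarrow> g f) G"
      by (rule continuous_on_tendsto_compose[OF continuous_on_product_coordinates]) auto
    then show ?thesis using that by (simp add: \<Theta>_def)
  qed
  ultimately show ?thesis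
    by (intro exI[of _ G]) (auto simp: G_def)
qed

section \<open>Functionals and M-ideals\<close>

text \<open>The norm laws are required on \<open>X\<close> only, since \<open>poly_norm\<close> is a
  supremum that may be meaningless for arbitrary functions. Both the polynomial space and the domain
  space, with carrier \<open>UNIV\<close>, are instances.\<close>

locale normed_carrier = module s
  for s :: "'k::rc_field \<Rightarrow> 'v::ab_group_add \<Rightarrow> 'v" +
  fixes X :: "'v set" and N :: "'v \<Rightarrow> real"
  assumes subspace: "subspace X"
    and N_scale: "x \<in> X \<Longrightarrow> N (s c x) = norm c * N x"
    and N_triangle: "x \<in> X \<Longrightarrow> y \<in> X \<Longrightarrow> N (x + y) \<le> N x + N y"
    and N_zeroD: "x \<in> X \<Longrightarrow> N x = 0 \<Longrightarrow> x = 0"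
begin

lemmas zero_in = subspace_0[OF subspace]
  and add_in = subspace_add[OF subspace]
  and diff_in = subspace_diff[OF subspace]
  and scale_in = subspace_scale[OF subspace]

lemma N_zero [simp]: "N 0 = 0"
  using N_scale[of 0 0] zero_in by simp

lemma N_minus: "x \<in> X \<Longrightarrow> N (- x) = N x"
  using N_scale[of x "- 1"] by simp

lemma N_commute: "x \<in> X \<Longrightarrow> y \<in> X \<Longrightarrow> N (x - y) = N (y - x)"
  using N_minus[of "x - y"] diff_in by simp

lemma N_triangle_diff: "x \<in> X \<Longrightarrow> y \<in> X \<Longrightarrow> N x \<le> N (x - y) + N y"
  using N_triangle[of "x - y" y] diff_in by simp

lemma N_diff_le: "x \<in> X \<Longrightarrow> y \<in> X \<Longrightarrow> N (x - y) \<le> N x + N y"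
  using N_triangle[of x "- y"] N_minus subspace_neg[OF subspace] by simp

lemma N_nonneg: "x \<in> X \<Longrightarrow> 0 \<le> N x"
  using N_diff_le[of x x] by simp

text \<open>The metric is written exactly as in \<open>norm_topology\<close>, default value
  included, so that the two topologies agree by unfolding.\<close>

sublocale Metric_space X "\<lambda>x y. if x \<in> X \<and> y \<in> X then N (x - y) else 0"
proof
  fix x y z assume "x \<in> X" "y \<in> X" "z \<in> X"
  then show "(if x \<in> X \<and> z \<in> X then N (x - z) else 0) \<le>
      (if x \<in> X \<and> y \<in> X then N (x - y) else 0) + (if y \<in> X \<and> z \<in> X then N (y - z) else 0)"
    using N_triangle[of "x - y" "y - z"] diff_in by simp
next
  fix x y assume "x \<in> X" "y \<in> X"
  then show "(if x \<in> X \<and> y \<in> X then N (x - y) else 0) = 0 \<longleftrightarrow> x = y"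
    using N_zeroD[of "x - y"] diff_in by auto
qed (auto simp: N_nonneg diff_in N_commute)

lemma norm_topology_eq: "norm_topology X N = mtopology"
  by (simp add: norm_topology_def)

lemma mem_mball: "y \<in> mball x r \<longleftrightarrow> x \<in> X \<and> y \<in> X \<and> N (x - y) < r"
  by (auto simp: mball_def)

lemma norm_le_dual_norm_of_ball:
  assumes "\<phi> \<in> dual s X N" "x \<in> unit_ball X N"
  shows "norm (\<phi> x) \<le> dual_norm X N \<phi>"
proof -
  obtain C where C: "\<And>x. x \<in> X \<Longrightarrow> norm (\<phi> x) \<le> C * N x"
    using assms(1) unfolding dual_def by blast
  \<comment> \<open>The absolute value is taken because the constant in \<open>dual\<close> may be
    negative when \<open>N\<close> vanishes on all of \<open>X\<close>.\<close>
  have "norm (\<phi> x) \<le> \<bar>C\<bar>" if "x \<in> unit_ball X N" for x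
  proof -
    have "norm (\<phi> x) \<le> C * N x" using that C by (auto simp: unit_ball_def)
    also have "\<dots> \<le> \<bar>C\<bar> * 1" using that N_nonneg by (intro mult_mono) (auto simp: unit_ball_def)
    finally show ?thesis by simp
  qed
  then have "bdd_above ((\<lambda>x. norm (\<phi> x)) ` unit_ball X N)" by (rule bdd_aboveI2)
  then show ?thesis unfolding dual_norm_def using assms(2) by (rule cSUP_upper[rotated])
qed

lemma dual_norm_nonneg: "\<phi> \<in> dual s X N \<Longrightarrow> 0 \<le> dual_norm X N \<phi>"
  using order_trans[OF norm_ge_zero norm_le_dual_norm_of_ball[of \<phi> 0]] zero_in
  by (simp add: unit_ball_def)

lemma norm_le_dual_norm:
  assumes \<phi>: "\<phi> \<in> dual s X N" and x: "x \<in> X"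
  shows "norm (\<phi> x) \<le> dual_norm X N \<phi> * N x"
proof (cases "N x = 0")
  case True
  then show ?thesis using assms by (force simp: dual_def)
next
  case False
  then have "N x > 0" using N_nonneg[OF x] by simp
  define y where "y = s (of_real (inverse (N x))) x"
  have "N y = 1" using \<open>N x > 0\<close> by (simp add: y_def N_scale x del: of_real_inverse)
  then have "norm (\<phi> y) \<le> dual_norm X N \<phi>"
    using \<phi> x by (intro norm_le_dual_norm_of_ball) (auto simp: unit_ball_def y_def scale_in)
  moreover have "norm (\<phi> y) = norm (\<phi> x) / N x"
    using \<phi> x \<open>N x > 0\<close> by (simp add: y_def dual_def norm_mult divide_inverse del: of_real_inverse)
  ultimately show ?thesis using \<open>N x > 0\<close> by (simp add: field_simps)
qed

lemma dual_norm_le: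
  assumes "\<And>x. x \<in> X \<Longrightarrow> norm (\<phi> x) \<le> N x"
  shows "dual_norm X N \<phi> \<le> 1"
  unfolding dual_norm_def
proof (rule cSUP_least)
  show "unit_ball X N \<noteq> {}" using zero_in by (auto simp: unit_ball_def intro!: exI[of _ 0])
next
  fix x assume "x \<in> unit_ball X N"
  then show "norm (\<phi> x) \<le> 1" using assms[of x] by (simp add: unit_ball_def)
qed

lemma dual_norm_eq_0_imp:
  assumes "\<phi> \<in> dual s X N" "dual_norm X N \<phi> = 0"
  shows "\<phi> = (\<lambda>_. 0)"
proof
  fix x
  show "\<phi> x = 0"
    using norm_le_dual_norm[OF assms(1), of x] assms by (cases "x \<in> X") (auto simp: dual_def)
qed

lemma dual_add:
  assumes "\<phi> \<in> dual s X N" "\<psi> \<in> dual s X N"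
  shows "\<phi> + \<psi> \<in> dual s X N"
proof -
  have "norm (\<phi> x + \<psi> x) \<le> (dual_norm X N \<phi> + dual_norm X N \<psi>) * N x" if "x \<in> X" for x
    using norm_triangle_ineq[of "\<phi> x" "\<psi> x"] norm_le_dual_norm[OF assms(1) that]
      norm_le_dual_norm[OF assms(2) that] by (simp add: distrib_right)
  then show ?thesis
    using assms unfolding dual_def
    by (intro CollectI conjI exI[of _ "dual_norm X N \<phi> + dual_norm X N \<psi>"])
      (auto simp: distrib_left)
qed

lemma dual_scale:
  assumes "\<phi> \<in> dual s X N"
  shows "fscale (*) c \<phi> \<in> dual s X N"
proof -
  have "norm (c * \<phi> x) \<le> (norm c * dual_norm X N \<phi>) * N x" if "x \<in> X" for x
    using mult_left_mono[OF norm_le_dual_norm[OF assms that], of "norm c"]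
    by (simp add: norm_mult mult.assoc)
  then show ?thesis
    using assms unfolding dual_def fscale_def
    by (intro CollectI conjI exI[of _ "norm c * dual_norm X N \<phi>"]) (auto simp: distrib_left)
qed

lemma dual_diff:
  assumes "\<phi> \<in> dual s X N" "\<psi> \<in> dual s X N"
  shows "\<phi> - \<psi> \<in> dual s X N"
proof -
  have "\<phi> - \<psi> = \<phi> + fscale (*) (- 1) \<psi>" by (simp add: fscale_def fun_eq_iff)
  then show ?thesis using assms dual_add dual_scale by presburger
qed

text \<open>
  The identity for the dual norm forces a functional whose restriction to \<open>J\<close> has full norm to lie in
  the range of the projection, and such functionals are determined by their restriction to \<open>J\<close>. The
  assumptions on \<open>T\<close> and \<open>Q\<close> say that \<open>\<phi>\<close> norms a vector that is closer to \<open>J\<close> than to \<open>0\<close>; hence \<open>\<phi>\<close>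
  has no component in the annihilator of \<open>J\<close>.
\<close>

lemma M_ideal_functional_unique:
  assumes M: "M_ideal s X N J"
    and \<phi>: "\<phi> \<in> dual s X N" "dual_norm X N \<phi> \<le> 1"
    and \<psi>: "\<psi> \<in> dual s X N" "dual_norm X N \<psi> \<le> 1"
    and eq: "\<And>x. x \<in> J \<Longrightarrow> \<phi> x = \<psi> x"
    and T: "T \<in> X" and Q: "Q \<in> J" "Q \<in> X"
    and less: "N (T - Q) < N T" and norming: "N T \<le> norm (\<phi> T)"
  shows "\<phi> = \<psi>"
proof -
  let ?n = "dual_norm X N"
  obtain p where p: "linear_projection_on (fscale (*)) (dual s X N) p"
    and ker: "{\<phi> \<in> dual s X N. p \<phi> = 0} = annihilator s X N J"
    and split: "\<And>\<phi>. \<phi> \<in> dual s X N \<Longrightarrow> ?n \<phi> = ?n (p \<phi>) + ?n (\<phi> - p \<phi>)"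
    using M unfolding M_ideal_def by blast
  have p_in: "p \<eta> \<in> dual s X N" and pp: "p (p \<eta>) = p \<eta>" if "\<eta> \<in> dual s X N" for \<eta>
    using p that by (auto simp: linear_projection_on_def)
  have p_diff: "p (\<eta> - \<omega>) = p \<eta> - p \<omega>" if "\<eta> \<in> dual s X N" "\<omega> \<in> dual s X N" for \<eta> \<omega>
  proof -
    have "p ((\<eta> - \<omega>) + \<omega>) = p (\<eta> - \<omega>) + p \<omega>"
      using p that dual_diff unfolding linear_projection_on_def by blast
    then show ?thesis by simp
  qed
  define \<eta> where "\<eta> = \<phi> - p \<phi>"
  have \<eta>_in: "\<eta> \<in> dual s X N"
    unfolding \<eta>_def using \<phi>(1) p_in by (blast intro: dual_diff)
  have "p \<eta> = 0"
    unfolding \<eta>_def using p_diff[OF \<phi>(1) p_in[OF \<phi>(1)]] pp[OF \<phi>(1)] by simp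
  then have "\<eta> \<in> annihilator s X N J" using ker \<eta>_in by blast
  then have "\<eta> Q = 0" using Q(1) by (simp add: annihilator_def)
  have "\<eta> ((T - Q) + Q) = \<eta> (T - Q) + \<eta> Q"
    using \<eta>_in T Q(2) diff_in unfolding dual_def by blast
  then have "\<eta> T = \<eta> (T - Q)" using \<open>\<eta> Q = 0\<close> by simp
  then have "norm (\<eta> T) \<le> ?n \<eta> * N (T - Q)"
    using norm_le_dual_norm[OF \<eta>_in diff_in[OF T Q(2)]] by simp
  moreover have "\<phi> T = p \<phi> T + \<eta> T" by (simp add: \<eta>_def)
  then have "norm (\<phi> T) \<le> norm (p \<phi> T) + norm (\<eta> T)" by (simp add: norm_triangle_ineq)
  moreover have "norm (p \<phi> T) \<le> ?n (p \<phi>) * N T"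
    using norm_le_dual_norm[OF p_in[OF \<phi>(1)] T] .
  ultimately have le: "N T \<le> ?n (p \<phi>) * N T + ?n \<eta> * N (T - Q)"
    using norming by linarith
  have sum: "?n (p \<phi>) + ?n \<eta> \<le> 1" using split[OF \<phi>(1)] \<phi>(2) by (simp add: \<eta>_def)
  \<comment> \<open>Inserting this into \<open>le\<close> bounds the norm of \<eta> times the
    positive gap \<open>N T - N (T - Q)\<close> by 0, so \<eta> vanishes.\<close>
  have "?n (p \<phi>) * N T \<le> (1 - ?n \<eta>) * N T"
    using sum N_nonneg[OF T] by (intro mult_right_mono) auto
  with le have "?n \<eta> * (N T - N (T - Q)) \<le> 0" by (simp add: algebra_simps)
  then have "?n \<eta> = 0"
    using less dual_norm_nonneg[OF \<eta>_in] by (simp add: mult_le_0_iff)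
  then have "\<phi> = p \<phi>"
    using dual_norm_eq_0_imp[OF \<eta>_in] by (auto simp: \<eta>_def fun_eq_iff)
  have "N T > 0" using less N_nonneg[OF diff_in[OF T Q(2)]] by linarith
  then have "?n (p \<phi>) \<ge> 1" using le \<open>?n \<eta> = 0\<close> by simp
  \<comment> \<open>Agreement on \<open>J\<close> gives \<phi> and \<psi> the same projection. As
    its norm is at least 1, the norm identity for \<psi> leaves nothing for the complementary
    part.\<close>
  have "\<psi> - \<phi> \<in> annihilator s X N J"
    using \<phi>(1) \<psi>(1) eq by (simp add: annihilator_def dual_diff)
  then have "p (\<psi> - \<phi>) = 0" using ker by blast
  then have "p \<psi> = p \<phi>" using p_diff[OF \<psi>(1) \<phi>(1)] by simp
  then have "?n (\<psi> - p \<psi>) \<le> 0" using split[OF \<psi>(1)] \<psi>(2) \<open>?n (p \<phi>) \<ge> 1\<close> by simp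
  moreover have "\<psi> - p \<psi> \<in> dual s X N" using \<psi>(1) p_in dual_diff by blast
  ultimately have "\<psi> = p \<psi>"
    using dual_norm_eq_0_imp[of "\<psi> - p \<psi>"] dual_norm_nonneg by (force simp: fun_eq_iff)
  then show ?thesis using \<open>p \<psi> = p \<phi>\<close> \<open>\<phi> = p \<phi>\<close> by simp
qed

end

section \<open>Homogeneous polynomials\<close>

lemma module_fscale:
  assumes "vector_space s"
  shows "module (fscale s)"
proof -
  interpret vector_space s by (rule assms)
  show ?thesis
    by standard (auto simp: fscale_def plus_fun_def scale_right_distrib scale_left_distrib)
qed

locale hpoly_space = E: normed_space_over sE + F: normed_space_over sF
  for sE :: "'k::rc_field \<Rightarrow> 'e::real_normed_vector \<Rightarrow> 'e"
    and sF :: "'k \<Rightarrow> 'f::real_normed_vector \<Rightarrow> 'f" +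
  fixes n :: nat
  assumes n_ge_1: "n \<ge> 1"
begin

abbreviation "X \<equiv> hpoly n sE sF"
abbreviation "J \<equiv> hpoly_w n sE sF"

lemma multilinear_iff:
  "multilinear n sE sF A \<longleftrightarrow>
     (\<forall>v. \<forall>i<n. (\<forall>x y. A (v(i := x + y)) = A (v(i := x)) + A (v(i := y))) \<and>
                (\<forall>c x. A (v(i := sE c x)) = sF c (A (v(i := x))))) \<and>
     (\<forall>v w. (\<forall>i<n. v i = w i) \<longrightarrow> A v = A w)"
  unfolding multilinear_def Vector_Spaces.linear_iff
  using E.vector_space_axioms F.vector_space_axioms by auto

lemma multilinear_cong: "multilinear n sE sF A \<Longrightarrow> (\<And>i. i < n \<Longrightarrow> v i = w i) \<Longrightarrow> A v = A w"
  unfolding multilinear_def by blast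

text \<open>The scalar is pulled out of one slot at a time, by induction on the number
  \<open>k\<close> of scaled slots. At k = n the sequence differs from the constant one only in
  entries that \<open>multilinear_cong\<close> ignores.\<close>

lemma hpoly_scale_arg:
  assumes "P \<in> X"
  shows "P (sE c x) = sF (c ^ n) (P x)"
proof -
  obtain A where A: "multilinear n sE sF A" and P: "\<And>x. P x = A (\<lambda>_. x)"
    using assms by (auto simp: hpoly_def)
  have "A (\<lambda>i. if i < k then sE c x else x) = sF (c ^ k) (A (\<lambda>_. x))" if "k \<le> n" for k
    using that
  proof (induction k)
    case (Suc k)
    let ?v = "\<lambda>i. if i < k then sE c x else x"
    have "(\<lambda>i. if i < Suc k then sE c x else x) = ?v(k := sE c x)"
      by (auto simp: fun_eq_iff)
    then have "A (\<lambda>i. if i < Suc k then sE c x else x) = sF c (A (?v(k := x)))"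
      using A Suc.prems unfolding multilinear_iff by simp
    also have "?v(k := x) = ?v" by (auto simp: fun_eq_iff)
    finally show ?case using Suc by simp
  qed simp
  moreover have "A (\<lambda>i. if i < n then sE c x else x) = A (\<lambda>_. sE c x)"
    by (rule multilinear_cong[OF A]) simp
  ultimately show ?thesis by (simp add: P)
qed

lemma norm_hpoly_scaleR: "P \<in> X \<Longrightarrow> norm (P (r *\<^sub>R x)) = \<bar>r\<bar> ^ n * norm (P x)"
  using hpoly_scale_arg[of P "of_real r" x]
  by (simp add: E.scale_of_real F.norm_scale norm_power)

lemma hpoly_at_zero: "P \<in> X \<Longrightarrow> P 0 = 0"
  using norm_hpoly_scaleR[of P 0 0] n_ge_1 by (auto simp: power_0_left split: if_splits)

text \<open>Continuity at 0 bounds \<open>P\<close> on a small ball, and homogeneity carries the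
  bound to the unit ball. This makes the supremum in \<open>poly_norm\<close> meaningful.\<close>

lemma hpoly_bounded:
  assumes P: "P \<in> X"
  shows "bdd_above ((\<lambda>x. norm (P x)) ` cball 0 1)"
proof -
  have "isCont P 0"
    using P by (simp add: hpoly_def continuous_on_eq_continuous_at)
  then obtain d where d: "d > 0" "\<And>x. norm x < d \<Longrightarrow> norm (P x) < 1"
    unfolding continuous_at_eps_delta using hpoly_at_zero[OF P]
    by (metis diff_zero dist_norm zero_less_one)
  have "norm (P x) \<le> (2 / d) ^ n" if "norm x \<le> 1" for x
  proof -
    have "norm ((d / 2) *\<^sub>R x) < d" using that d(1) mult_left_mono[of "norm x" 1 "d / 2"] by simp
    then have "(d / 2) ^ n * norm (P x) < 1"
      using d(2)[of "(d / 2) *\<^sub>R x"] norm_hpoly_scaleR[OF P, of "d / 2" x] d(1) by simp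
    then show ?thesis using d(1) by (simp add: field_simps)
  qed
  then show ?thesis by (intro bdd_aboveI2) simp
qed

lemma norm_le_poly_norm: "P \<in> X \<Longrightarrow> norm x \<le> 1 \<Longrightarrow> norm (P x) \<le> poly_norm P"
  unfolding poly_norm_def using hpoly_bounded by (intro cSUP_upper) auto

lemma poly_norm_le: "(\<And>x. norm x \<le> 1 \<Longrightarrow> norm (P x) \<le> C) \<Longrightarrow> poly_norm P \<le> C"
  unfolding poly_norm_def by (intro cSUP_least) auto

lemma subspace_hpoly: "module.subspace (fscale sF) X"
proof -
  interpret module "fscale sF" by (rule module_fscale) (rule F.vector_space_axioms)
  show ?thesis
  proof (rule subspaceI)
    have "multilinear n sE sF (\<lambda>_. 0)" by (simp add: multilinear_iff)
    then show "0 \<in> X" by (auto simp: hpoly_def zero_fun_def)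
  next
    fix P Q assume "P \<in> X" "Q \<in> X"
    then obtain A B where AB: "multilinear n sE sF A" "multilinear n sE sF B"
      and eq: "\<And>x. P x = A (\<lambda>_. x)" "\<And>x. Q x = B (\<lambda>_. x)"
      and cont: "continuous_on UNIV P" "continuous_on UNIV Q"
      by (auto simp: hpoly_def)
    have "multilinear n sE sF (\<lambda>v. A v + B v)"
      using AB unfolding multilinear_iff
      by (simp add: F.scale_right_distrib ac_simps) metis
    moreover have "continuous_on UNIV (\<lambda>x. P x + Q x)"
      using cont by (rule continuous_on_add)
    ultimately show "P + Q \<in> X"
      using eq by (auto simp: hpoly_def plus_fun_def intro!: exI[of _ "\<lambda>v. A v + B v"])
  next
    fix c P assume "P \<in> X"
    then obtain A where A: "multilinear n sE sF A" and eq: "\<And>x. P x = A (\<lambda>_. x)"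
      and cont: "continuous_on UNIV P"
      by (auto simp: hpoly_def)
    have "multilinear n sE sF (\<lambda>v. sF c (A v))"
      using A unfolding multilinear_iff
      by (simp add: F.scale_right_distrib F.scale_left_commute[of c])
    moreover have "bounded_linear (sF c)"
      by (rule bounded_linear_intro[where K = "norm c"])
        (simp_all add: F.scale_right_distrib F.norm_scale mult.commute flip: F.scale_of_real)
    then have "continuous_on UNIV (\<lambda>x. sF c (P x))"
      using cont by (rule bounded_linear.continuous_on)
    ultimately show "fscale sF c P \<in> X"
      using eq by (auto simp: hpoly_def fscale_def intro!: exI[of _ "\<lambda>v. sF c (A v)"])
  qed
qed

sublocale P: normed_carrier "fscale sF" X poly_norm
proof -
  interpret module "fscale sF" by (rule module_fscale) (rule F.vector_space_axioms)
  show "normed_carrier (fscale sF) X poly_norm"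
  proof
    show "subspace X" by (rule subspace_hpoly)
  next
    fix P c assume P: "P \<in> X"
    have cP: "fscale sF c P \<in> X" for c
      using P subspace_hpoly by (rule subspace_scale[rotated])
    have le: "poly_norm (fscale sF c P) \<le> norm c * poly_norm P" for c
      using P by (intro poly_norm_le)
        (auto simp: fscale_def F.norm_scale intro!: mult_left_mono norm_le_poly_norm)
    show "poly_norm (fscale sF c P) = norm c * poly_norm P"
    proof (cases "c = 0")
      case True
      then have "fscale sF c P = (\<lambda>_. 0)" by (simp add: fscale_def)
      then show ?thesis using True by (simp add: poly_norm_def)
    next
      case False
      have "norm c * norm (P x) \<le> poly_norm (fscale sF c P)" if "norm x \<le> 1" for x
        using norm_le_poly_norm[OF cP[of c] that] by (simp add: fscale_def F.norm_scale)
      then have "poly_norm P \<le> poly_norm (fscale sF c P) / norm c"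
        using False by (intro poly_norm_le) (simp add: field_simps)
      then show ?thesis using le[of c] False by (simp add: field_simps)
    qed
  next
    fix P Q assume "P \<in> X" "Q \<in> X"
    then show "poly_norm (P + Q) \<le> poly_norm P + poly_norm Q"
      by (intro poly_norm_le) (auto intro!: norm_triangle_mono norm_le_poly_norm)
  next
    fix P assume P: "P \<in> X" "poly_norm P = 0"
    show "P = 0"
    proof
      fix x :: 'e
      have "norm x *\<^sub>R sgn x = x" by (cases "x = 0") (simp_all add: sgn_div_norm)
      moreover have "norm (P (sgn x)) \<le> 0"
        using norm_le_poly_norm[OF P(1), of "sgn x"] P(2) by (simp add: norm_sgn)
      ultimately show "P x = 0 x"
        using norm_hpoly_scaleR[OF P(1), of "norm x" "sgn x"] by simp
    qed
  qed
qed

section \<open>Rank-one polynomials\<close>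

lemma tendsto_rank_one:
  assumes "(\<alpha> \<longlongrightarrow> a) G"
  shows "((\<lambda>y. sF (\<alpha> y ^ n) w) \<longlongrightarrow> sF (a ^ n) w) G"
proof -
  have "bounded_linear (\<lambda>c. sF c w)"
  proof (rule bounded_linear_intro[where K = "norm w"])
    fix r and c :: 'k
    show "sF (r *\<^sub>R c) w = r *\<^sub>R sF c w"
      by (simp add: scaleR_conv_of_real flip: F.scale_of_real)
  qed (simp_all add: F.scale_left_distrib F.norm_scale)
  then show ?thesis
    using assms by (intro bounded_linear.tendsto[of "\<lambda>c. sF c w"] tendsto_power)
qed

lemma dual_UNIV_continuous:
  assumes "\<alpha> \<in> dual sE UNIV norm"
  shows "isCont \<alpha> x"
proof -
  obtain C where C: "\<And>x. norm (\<alpha> x) \<le> C * norm x"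
    and add: "\<And>x y. \<alpha> (x + y) = \<alpha> x + \<alpha> y"
    and scale: "\<And>c x. \<alpha> (sE c x) = c * \<alpha> x"
    using assms unfolding dual_def by blast
  have "bounded_linear \<alpha>"
  proof (rule bounded_linear_intro[where K = C])
    fix r x show "\<alpha> (r *\<^sub>R x) = r *\<^sub>R \<alpha> x"
      using scale[of "of_real r" x] by (simp add: E.scale_of_real scaleR_conv_of_real)
  qed (use C add in \<open>simp_all add: mult.commute\<close>)
  then show ?thesis by (rule linear_continuous_at)
qed

lemma rank_one_in_hpoly_w:
  assumes \<alpha>: "\<alpha> \<in> dual sE UNIV norm"
  shows "(\<lambda>x. sF (\<alpha> x ^ n) w) \<in> J"
proof -
  let ?A = "\<lambda>v. sF (\<Prod>i<n. \<alpha> (v i)) w"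
  \<comment> \<open>Splitting off the factor of slot \<open>i\<close> displays the product as linear
    in that slot.\<close>
  have prod: "(\<Prod>k<n. \<alpha> ((v(i := x)) k)) = \<alpha> x * (\<Prod>k\<in>{..<n} - {i}. \<alpha> (v k))" if "i < n" for v i x
    using that by (subst prod.remove[of _ i]) (auto intro!: prod.cong)
  have "multilinear n sE sF ?A"
    unfolding multilinear_iff
  proof (intro conjI allI impI)
    fix v w' assume "\<forall>i<n. v i = (w' i :: 'e)"
    then have "(\<Prod>i<n. \<alpha> (v i)) = (\<Prod>i<n. \<alpha> (w' i))" by simp
    then show "?A v = ?A w'" by simp
  qed (use \<alpha> in \<open>simp_all only: prod dual_def mem_Collect_eq UNIV_I ball_UNIV distrib_right
      F.scale_left_distrib F.scale_scale mult.assoc\<close>)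
  moreover have "continuous_on UNIV (\<lambda>x. sF (\<alpha> x ^ n) w)"
    using dual_UNIV_continuous[OF \<alpha>] unfolding continuous_on_def isCont_def
    by (blast intro: tendsto_rank_one)
  ultimately have "(\<lambda>x. sF (\<alpha> x ^ n) w) \<in> X"
    by (auto simp: hpoly_def intro!: exI[of _ ?A])
  moreover have "weakly_continuous_on_bounded sE (\<lambda>x. sF (\<alpha> x ^ n) w)"
    unfolding weakly_continuous_on_bounded_def weakly_converges_def
    by (intro allI impI tendsto_norm_zero LIM_zero tendsto_rank_one) (use \<alpha> in blast)
  ultimately show ?thesis by (simp add: hpoly_w_def)
qed

text \<open>The witness is a negative rank-one polynomial adapted to \<open>P\<close> at a unit
  vector \<open>u\<close>: with \<alpha> norming \<open>u\<close> and \<open>w\<close> a unit vector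
  along \<open>P u\<close>, subtracting t Q lengthens \<open>P u\<close> by exactly t. Nontriviality
  of both spaces supplies directions when \<open>x\<close> or \<open>P u\<close> is zero. The case t
  = 1 yields farthest points, small t yields density.\<close>

lemma exists_far_direction:
  assumes P: "P \<in> X" and x: "norm x \<le> 1"
    and nontrivial: "\<exists>e::'e. e \<noteq> 0" "\<exists>f::'f. f \<noteq> 0"
  shows "\<exists>Q\<in>unit_ball J poly_norm. \<forall>t\<ge>0. norm (P x) + t \<le> poly_norm (P - fscale sF (of_real t) Q)"
proof -
  obtain e :: 'e where "e \<noteq> 0" using nontrivial by blast
  define u where "u = (if x = 0 then sgn e else sgn x)"
  have u: "norm u = 1" using \<open>e \<noteq> 0\<close> by (simp add: u_def norm_sgn)
  have "norm (P x) \<le> norm (P u)"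
  proof (cases "x = 0")
    case True
    then show ?thesis using hpoly_at_zero[OF P] by simp
  next
    case False
    then have "norm (P x) = norm x ^ n * norm (P u)"
      using norm_hpoly_scaleR[OF P, of "norm x" u] by (simp add: u_def sgn_div_norm)
    then show ?thesis using x by (simp add: mult_left_le_one_le power_le_one)
  qed
  obtain f :: 'f where "f \<noteq> 0" using nontrivial by blast
  define w where "w = (if P u = 0 then sgn f else sgn (P u))"
  have w: "norm w = 1" "P u = norm (P u) *\<^sub>R w"
    using \<open>f \<noteq> 0\<close> by (auto simp: w_def norm_sgn sgn_div_norm)
  obtain \<alpha> where \<alpha>: "\<alpha> \<in> dual sE UNIV norm" "\<And>z. norm (\<alpha> z) \<le> norm z" "\<alpha> u = 1"
    using norming_functional[OF E.normed_space_over_axioms, of u] u by auto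
  define Q where "Q = (\<lambda>x. sF (\<alpha> x ^ n) (- w))"
  have "Q \<in> J" unfolding Q_def using \<alpha>(1) by (rule rank_one_in_hpoly_w)
  have "poly_norm Q \<le> 1"
  proof (rule poly_norm_le)
    fix z :: 'e assume "norm z \<le> 1"
    then have "norm (\<alpha> z) \<le> 1" using \<alpha>(2)[of z] by linarith
    then show "norm (Q z) \<le> 1" by (simp add: Q_def F.norm_scale w norm_power power_le_one)
  qed
  moreover have "norm (P x) + t \<le> poly_norm (P - fscale sF (of_real t) Q)" if "t \<ge> 0" for t
  proof -
    have "(P - fscale sF (of_real t) Q) u = norm (P u) *\<^sub>R w + t *\<^sub>R w"
      using w(2) by (simp add: fscale_def Q_def \<alpha>(3) F.scale_of_real)
    also have "\<dots> = (norm (P u) + t) *\<^sub>R w" by (simp only: scaleR_add_left)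
    finally have "norm ((P - fscale sF (of_real t) Q) u) = norm (P u) + t"
      using that w(1) by simp
    moreover have "P - fscale sF (of_real t) Q \<in> X"
      using P \<open>Q \<in> J\<close> by (intro P.diff_in P.scale_in) (auto simp: hpoly_w_def)
    ultimately show ?thesis
      using norm_le_poly_norm[of _ u] u \<open>norm (P x) \<le> norm (P u)\<close> by fastforce
  qed
  ultimately show ?thesis using \<open>Q \<in> J\<close> by (auto simp: unit_ball_def)
qed

section \<open>Norm attainment\<close>

text \<open>Vectors \<open>x m\<close> almost norm \<open>T\<close>, and functionals
  \<open>y m\<close> norm the values \<open>T (x m)\<close>. One filter \<open>G\<close> serves all
  limits: \<phi> is the limit of the joint evaluations, whereas \<psi> is formed after taking the
  limits \<open>x0\<close> and \<open>y0\<close> separately.\<close>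

lemma norming_functional_and_evaluation:
  assumes refl: "reflexive sE" and T: "T \<in> X"
  obtains x \<phi> \<psi> where "norm x \<le> 1"
    "\<phi> \<in> dual (fscale sF) X poly_norm" "dual_norm X poly_norm \<phi> \<le> 1"
    "\<psi> \<in> dual (fscale sF) X poly_norm" "dual_norm X poly_norm \<psi> \<le> 1"
    "\<phi> T = of_real (poly_norm T)"
    "\<And>S. S \<in> J \<Longrightarrow> \<phi> S = \<psi> S"
    "\<And>S. S \<in> X \<Longrightarrow> norm (\<psi> S) \<le> norm (S x)"
proof -
  have "\<exists>x. norm x \<le> 1 \<and> poly_norm T - inverse (real (Suc m)) < norm (T x)" for m
  proof -
    have "poly_norm T - inverse (real (Suc m)) < (SUP x\<in>cball 0 1. norm (T x))"
      by (simp add: poly_norm_def)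
    then show ?thesis
      using hpoly_bounded[OF T] by (subst (asm) less_cSUP_iff) auto
  qed
  then obtain x where x: "\<And>m. norm (x m) \<le> 1"
    "\<And>m. poly_norm T - inverse (real (Suc m)) < norm (T (x m))"
    by metis
  have "\<exists>y. \<forall>m. y m \<in> dual sF UNIV norm \<and> (\<forall>v. norm (y m v) \<le> norm v) \<and>
      y m (T (x m)) = of_real (norm (T (x m)))"
    using norming_functional[OF F.normed_space_over_axioms] by (intro choice) blast
  then obtain y where y: "\<And>m. y m \<in> dual sF UNIV norm" "\<And>m v. norm (y m v) \<le> norm v"
    "\<And>m. y m (T (x m)) = of_real (norm (T (x m)))"
    by blast
  have y_add: "y m (v + w) = y m v + y m w" and y_scale: "y m (sF c v) = c * y m v" for m c v w
    using y(1)[of m] by (auto simp: dual_def)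
  have y_diff: "y m (v - w) = y m v - y m w" for m v w
    using y_add[of m "v - w" w] by simp
  obtain G where G: "G \<le> sequentially" "G \<noteq> bot"
    and conv: "\<And>f::nat \<Rightarrow> 'k. Bseq f \<Longrightarrow> \<exists>l. (f \<longlongrightarrow> l) G"
    using subfilter_all_bounded_converge by blast
  define L :: "(nat \<Rightarrow> 'k) \<Rightarrow> 'k" where "L f = Lim G f" for f
  have L_eq: "L f = l" if "(f \<longlongrightarrow> l) G" for f l
    unfolding L_def using G(2) that by (rule tendsto_Lim)
  have L_lim: "(f \<longlongrightarrow> L f) G" if "\<And>m. norm (f m) \<le> C" for f C
  proof -
    have "Bseq f" using that by (rule BseqI')
    then obtain l where "(f \<longlongrightarrow> l) G" using conv by blast
    then show ?thesis using L_eq[of f l] by simp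
  qed
  have L_le: "norm (L f) \<le> C" if "\<And>m. norm (f m) \<le> C" for f C
  proof (rule tendsto_upperbound)
    show "((\<lambda>m. norm (f m)) \<longlongrightarrow> norm (L f)) G"
      using that by (intro tendsto_norm L_lim)
  qed (use that G(2) in auto)

  interpret E_normed: normed_carrier sE UNIV norm
    by standard (auto simp: E.norm_scale norm_triangle_ineq E.scale_right_distrib E.scale_left_distrib)
  \<comment> \<open>The limit of the evaluations at \<open>x m\<close> is an element of the bidual;
    the value 0 off the dual is required by \<open>dual\<close>. Reflexivity turns it into a point
    \<open>x0\<close>, the weak limit of \<open>x\<close> along \<open>G\<close>.\<close>
  define \<Phi> where "\<Phi> \<alpha> = (if \<alpha> \<in> dual sE UNIV norm then L (\<lambda>m. \<alpha> (x m)) else 0)" for \<alpha>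
  have \<alpha>_le: "norm (\<alpha> (x m)) \<le> dual_norm UNIV norm \<alpha>" if "\<alpha> \<in> dual sE UNIV norm" for \<alpha> m
    using that x(1) by (intro E_normed.norm_le_dual_norm_of_ball) (auto simp: unit_ball_def)
  have \<alpha>_lim: "((\<lambda>m. \<alpha> (x m)) \<longlongrightarrow> L (\<lambda>m. \<alpha> (x m))) G" if "\<alpha> \<in> dual sE UNIV norm" for \<alpha>
    using \<alpha>_le[OF that] by (rule L_lim)
  have "\<Phi> \<in> dual (fscale (*)) (dual sE UNIV norm) (dual_norm UNIV norm)"
  proof -
    let ?D = "dual sE UNIV norm"
    note mem = E_normed.dual_add E_normed.dual_scale
    have "\<Phi> (\<alpha> + \<beta>) = \<Phi> \<alpha> + \<Phi> \<beta>" if "\<alpha> \<in> ?D" "\<beta> \<in> ?D" for \<alpha> \<beta>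
      using L_eq[OF tendsto_add[OF \<alpha>_lim \<alpha>_lim], of \<alpha> \<beta>] that mem by (simp add: \<Phi>_def)
    moreover have "\<Phi> (fscale (*) c \<alpha>) = c * \<Phi> \<alpha>" if "\<alpha> \<in> ?D" for c \<alpha>
      using L_eq[OF tendsto_mult_left[OF \<alpha>_lim], of \<alpha> c] that mem by (simp add: \<Phi>_def fscale_def)
    moreover have "norm (\<Phi> \<alpha>) \<le> 1 * dual_norm UNIV norm \<alpha>" if "\<alpha> \<in> ?D" for \<alpha>
      using L_le[OF \<alpha>_le] that by (simp add: \<Phi>_def)
    moreover have "\<Phi> \<alpha> = 0" if "\<alpha> \<notin> ?D" for \<alpha>
      using that by (simp add: \<Phi>_def)
    ultimately show ?thesis
      unfolding dual_def[of "fscale (*)"] by blast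
  qed
  then obtain x0 where x0: "\<And>\<alpha>. \<alpha> \<in> dual sE UNIV norm \<Longrightarrow> \<Phi> \<alpha> = \<alpha> x0"
    using refl unfolding reflexive_def by blast
  have weak: "weakly_converges sE (filtermap x G) x0"
    unfolding weakly_converges_def filterlim_filtermap
    using \<alpha>_lim x0 by (simp add: \<Phi>_def)
  have "norm x0 \<le> 1"
  proof -
    obtain \<alpha> where \<alpha>: "\<alpha> \<in> dual sE UNIV norm" "\<And>z. norm (\<alpha> z) \<le> norm z" "\<alpha> x0 = of_real (norm x0)"
      using norming_functional[OF E.normed_space_over_axioms, of x0] by blast
    have "norm (L (\<lambda>m. \<alpha> (x m))) \<le> 1"
      using \<alpha>(2) x(1) by (intro L_le) (rule order_trans)
    then show ?thesis using x0[OF \<alpha>(1)] \<alpha>(1,3) by (simp add: \<Phi>_def)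
  qed

  define y0 where "y0 v = L (\<lambda>m. y m v)" for v
  have y0_lim: "((\<lambda>m. y m v) \<longlongrightarrow> y0 v) G" for v
    unfolding y0_def using y(2) by (rule L_lim)
  have y0_le: "norm (y0 v) \<le> norm v" for v
    unfolding y0_def using y(2) by (rule L_le)
  have y0_add: "y0 (v + w) = y0 v + y0 w" for v w
    using L_eq[OF tendsto_add[OF y0_lim y0_lim], of v w] by (simp add: y0_def y_add)
  have y0_scale: "y0 (sF c v) = c * y0 v" for c v
    using L_eq[OF tendsto_mult_left[OF y0_lim], of c v] by (simp add: y0_def y_scale)

  have le_poly: "norm (S (x m)) \<le> poly_norm S" if "S \<in> X" for S m
    using that x(1) by (rule norm_le_poly_norm)
  have yS_le: "norm (y m (S (x m))) \<le> poly_norm S" if "S \<in> X" for S m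
    using y(2)[of m "S (x m)"] le_poly[OF that, of m] by linarith
  have yS_lim: "((\<lambda>m. y m (S (x m))) \<longlongrightarrow> L (\<lambda>m. y m (S (x m)))) G" if "S \<in> X" for S
    using yS_le[OF that] by (rule L_lim)
  define \<phi> where "\<phi> S = (if S \<in> X then L (\<lambda>m. y m (S (x m))) else 0)" for S
  define \<psi> where "\<psi> S = (if S \<in> X then y0 (S x0) else 0)" for S
  have dualI: "\<eta> \<in> dual (fscale sF) X poly_norm" "dual_norm X poly_norm \<eta> \<le> 1"
    if "\<And>S R. S \<in> X \<Longrightarrow> R \<in> X \<Longrightarrow> \<eta> (S + R) = \<eta> S + \<eta> R"
      "\<And>c S. S \<in> X \<Longrightarrow> \<eta> (fscale sF c S) = c * \<eta> S"
      "\<And>S. S \<in> X \<Longrightarrow> norm (\<eta> S) \<le> poly_norm S"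
      "\<And>S. S \<notin> X \<Longrightarrow> \<eta> S = 0" for \<eta>
    using that P.dual_norm_le[of \<eta>] by (auto simp: dual_def intro!: exI[of _ 1])
  show thesis
  proof (rule that[of x0 \<phi> \<psi>])
    have "\<phi> (S + R) = \<phi> S + \<phi> R" if "S \<in> X" "R \<in> X" for S R
      using L_eq[OF tendsto_add[OF yS_lim yS_lim], of S R] that
      by (simp add: \<phi>_def y_add P.add_in)
    moreover have "\<phi> (fscale sF c S) = c * \<phi> S" if "S \<in> X" for c S
      using L_eq[OF tendsto_mult_left[OF yS_lim], of S c] that P.scale_in[OF that, of c]
      by (simp add: \<phi>_def y_scale fscale_def)
    moreover have "norm (\<phi> S) \<le> poly_norm S" if "S \<in> X" for S
      using L_le[OF yS_le] that by (simp add: \<phi>_def)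
    ultimately show "\<phi> \<in> dual (fscale sF) X poly_norm" "dual_norm X poly_norm \<phi> \<le> 1"
      using dualI[of \<phi>] by (auto simp: \<phi>_def)
  next
    have "\<psi> (S + R) = \<psi> S + \<psi> R" if "S \<in> X" "R \<in> X" for S R
      using that by (simp add: \<psi>_def y0_add P.add_in)
    moreover have "\<psi> (fscale sF c S) = c * \<psi> S" if "S \<in> X" for c S
      using that P.scale_in[OF that, of c] by (simp add: \<psi>_def y0_scale fscale_def)
    moreover have "norm (\<psi> S) \<le> poly_norm S" if "S \<in> X" for S
      using y0_le[of "S x0"] norm_le_poly_norm[OF that \<open>norm x0 \<le> 1\<close>] that by (simp add: \<psi>_def)
    ultimately show "\<psi> \<in> dual (fscale sF) X poly_norm" "dual_norm X poly_norm \<psi> \<le> 1"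
      using dualI[of \<psi>] by (auto simp: \<psi>_def)
  next
    have "(\<lambda>m. norm (T (x m))) \<longlonglongrightarrow> poly_norm T"
    proof (rule tendsto_sandwich[OF always_eventually always_eventually _ tendsto_const])
      show "(\<lambda>m. poly_norm T - inverse (real (Suc m))) \<longlonglongrightarrow> poly_norm T"
        using tendsto_diff[OF tendsto_const LIMSEQ_inverse_real_of_nat] by simp
      show "\<forall>m. poly_norm T - inverse (real (Suc m)) \<le> norm (T (x m))"
        using x(2) less_imp_le by blast
      show "\<forall>m. norm (T (x m)) \<le> poly_norm T"
        using le_poly[OF T] by blast
    qed
    then have "((\<lambda>m. y m (T (x m))) \<longlongrightarrow> of_real (poly_norm T)) G"
      unfolding y(3) using G(1) by (intro tendsto_of_real) (rule tendsto_mono)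
    then show "\<phi> T = of_real (poly_norm T)" using L_eq T by (simp add: \<phi>_def)
  next
    fix S assume S: "S \<in> J"
    have "\<forall>\<^sub>F z in filtermap x G. norm z \<le> 1"
      using x(1) by (simp add: eventually_filtermap)
    then have "((\<lambda>z. norm (S z - S x0)) \<longlongrightarrow> 0) (filtermap x G)"
      using S weak unfolding hpoly_w_def weakly_continuous_on_bounded_def by blast
    then have "((\<lambda>m. norm (S (x m) - S x0)) \<longlongrightarrow> 0) G"
      by (simp add: filterlim_filtermap)
    \<comment> \<open>The \<open>y m\<close> are contractions, so norm convergence of
      \<open>S (x m)\<close> suffices here although the functionals vary with \<open>m\<close>; the
      remaining term \<open>y m (S x0)\<close> tends to \<open>y0 (S x0)\<close>.\<close>
    then have "((\<lambda>m. y m (S (x m) - S x0)) \<longlongrightarrow> 0) G"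
      by (rule Lim_null_comparison[rotated]) (simp add: y(2))
    then have "((\<lambda>m. y m (S (x m) - S x0) + y m (S x0)) \<longlongrightarrow> 0 + y0 (S x0)) G"
      using y0_lim by (rule tendsto_add)
    then have "L (\<lambda>m. y m (S (x m))) = y0 (S x0)" using L_eq by (simp add: y_diff)
    then show "\<phi> S = \<psi> S" using S by (simp add: \<phi>_def \<psi>_def hpoly_w_def)
  qed (use y0_le \<open>norm x0 \<le> 1\<close> in \<open>auto simp: \<psi>_def\<close>)
qed

text \<open>The polynomial \<open>R\<close> that triggers uniqueness is kept separate from the
  normed polynomial \<open>T\<close>. Near \<open>J\<close> both are \<open>P\<close>; for a
  farthest point, \<open>T\<close> is \<open>P - Q\<close> and \<open>R\<close> is \<open>Q\<close>
  itself.\<close>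

lemma norming_functional_is_evaluation:
  assumes refl: "reflexive sE" and M: "M_ideal (fscale sF) X poly_norm J" and T: "T \<in> X"
  shows "\<exists>x \<phi>. norm x \<le> 1 \<and> \<phi> \<in> dual (fscale sF) X poly_norm \<and>
    dual_norm X poly_norm \<phi> \<le> 1 \<and> \<phi> T = of_real (poly_norm T) \<and>
    ((\<exists>R\<in>X. \<exists>Q\<in>J. poly_norm (R - Q) < poly_norm R \<and> poly_norm R \<le> norm (\<phi> R)) \<longrightarrow>
      (\<forall>S\<in>X. norm (\<phi> S) \<le> norm (S x)))"
proof -
  obtain x \<phi> \<psi> where *: "norm x \<le> 1"
    "\<phi> \<in> dual (fscale sF) X poly_norm" "dual_norm X poly_norm \<phi> \<le> 1"
    "\<psi> \<in> dual (fscale sF) X poly_norm" "dual_norm X poly_norm \<psi> \<le> 1"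
    "\<phi> T = of_real (poly_norm T)"
    "\<And>S. S \<in> J \<Longrightarrow> \<phi> S = \<psi> S"
    "\<And>S. S \<in> X \<Longrightarrow> norm (\<psi> S) \<le> norm (S x)"
    using norming_functional_and_evaluation[OF refl T] by blast
  have "\<phi> = \<psi>"
    if "R \<in> X" "Q \<in> J" "poly_norm (R - Q) < poly_norm R" "poly_norm R \<le> norm (\<phi> R)" for R Q
    using that by (intro P.M_ideal_functional_unique[OF M *(2-5,7)]) (auto simp: hpoly_w_def)
  then show ?thesis using *(1-3,6,8) by blast
qed

lemma norm_attainingI:
  assumes "P \<in> X" "norm x \<le> 1" "poly_norm P \<le> norm (P x)"
  shows "P \<in> norm_attaining n sE sF"
  using assms norm_le_poly_norm[of P x] unfolding norm_attaining_def by force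

lemma norm_attaining_if_near_J:
  assumes refl: "reflexive sE" and M: "M_ideal (fscale sF) X poly_norm J"
    and P: "P \<in> X" and Q: "Q \<in> J" "poly_norm (P - Q) < poly_norm P"
  shows "P \<in> norm_attaining n sE sF"
proof -
  obtain x \<phi> where "norm x \<le> 1" "\<phi> \<in> dual (fscale sF) X poly_norm"
    "dual_norm X poly_norm \<phi> \<le> 1" "\<phi> P = of_real (poly_norm P)"
    and *: "(\<exists>R\<in>X. \<exists>Q\<in>J. poly_norm (R - Q) < poly_norm R \<and> poly_norm R \<le> norm (\<phi> R)) \<longrightarrow>
      (\<forall>S\<in>X. norm (\<phi> S) \<le> norm (S x))"
    using norming_functional_is_evaluation[OF refl M P] by blast
  moreover from this have "norm (\<phi> P) \<le> norm (P x)" using * P Q by auto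
  ultimately show ?thesis using P P.N_nonneg[OF P] by (intro norm_attainingI[of P x]) simp_all
qed

lemma norm_attaining_if_far:
  assumes refl: "reflexive sE" and M: "M_ideal (fscale sF) X poly_norm J"
    and P: "P \<in> X" and Q: "Q \<in> unit_ball J poly_norm" "poly_norm (P - Q) = poly_norm P + 1"
  shows "P \<in> norm_attaining n sE sF"
proof -
  have Q_in: "Q \<in> J" "Q \<in> X" "poly_norm Q \<le> 1" using Q(1) by (auto simp: unit_ball_def hpoly_w_def)
  obtain x \<phi> where x: "norm x \<le> 1" and \<phi>: "\<phi> \<in> dual (fscale sF) X poly_norm"
    "dual_norm X poly_norm \<phi> \<le> 1" "\<phi> (P - Q) = of_real (poly_norm (P - Q))"
    and *: "(\<exists>R\<in>X. \<exists>Q\<in>J. poly_norm (R - Q) < poly_norm R \<and> poly_norm R \<le> norm (\<phi> R)) \<longrightarrow>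
      (\<forall>S\<in>X. norm (\<phi> S) \<le> norm (S x))"
    using norming_functional_is_evaluation[OF refl M P.diff_in[OF P Q_in(2)]] by blast
  have le: "norm (\<phi> S) \<le> poly_norm S" if "S \<in> X" for S
    using P.norm_le_dual_norm[OF \<phi>(1) that] mult_right_mono[OF \<phi>(2) P.N_nonneg[OF that]] by simp
  have "\<phi> ((P - Q) + Q) = \<phi> (P - Q) + \<phi> Q"
    using \<phi>(1) P.diff_in[OF P Q_in(2)] Q_in(2) unfolding dual_def by blast
  then have "\<phi> (P - Q) = \<phi> P - \<phi> Q" by simp
  then have "norm (\<phi> (P - Q)) \<le> norm (\<phi> P) + norm (\<phi> Q)"
    using norm_triangle_ineq4[of "\<phi> P" "\<phi> Q"] by simp
  moreover have "norm (\<phi> (P - Q)) = poly_norm P + 1"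
    unfolding \<phi>(3) norm_of_real Q(2) using P.N_nonneg[OF P] by simp
  \<comment> \<open>The two summands are at most \<open>poly_norm P\<close> and 1 and add up to at
    least \<open>poly_norm P + 1\<close>, so both bounds are attained.\<close>
  ultimately have "1 \<le> norm (\<phi> Q)" "poly_norm P \<le> norm (\<phi> P)" "poly_norm Q = 1"
    using le[OF P] le[OF Q_in(2)] Q_in(3) by linarith+
  \<comment> \<open>Uniqueness is triggered by \<open>Q\<close> with itself as approximant: the
    distance is 0, while \<open>Q\<close> has norm 1 and is normed by \<phi>.\<close>
  then have "norm (\<phi> P) \<le> norm (P x)"
    using * P Q_in(1,2) P.N_zero by (metis diff_self zero_less_one)
  then show ?thesis
    using \<open>poly_norm P \<le> norm (\<phi> P)\<close> P x by (intro norm_attainingI[of P x]) auto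
qed

section \<open>Farthest distance and farthest points\<close>

lemma farthest_dist_eq:
  assumes "P \<in> X" and nontrivial: "\<exists>e::'e. e \<noteq> 0" "\<exists>f::'f. f \<noteq> 0"
  shows "farthest_dist poly_norm P (unit_ball J poly_norm) = poly_norm P + 1"
proof (rule antisym)
  have ne: "unit_ball J poly_norm \<noteq> {}"
    using exists_far_direction[OF assms(1), of 0] nontrivial by auto
  have le: "poly_norm (P - Q) \<le> poly_norm P + 1" if "Q \<in> unit_ball J poly_norm" for Q
    using P.N_diff_le[OF assms(1), of Q] that by (auto simp: unit_ball_def hpoly_w_def)
  show "farthest_dist poly_norm P (unit_ball J poly_norm) \<le> poly_norm P + 1"
    unfolding farthest_dist_def using ne le by (rule cSUP_least)
  have bdd: "bdd_above ((\<lambda>Q. poly_norm (P - Q)) ` unit_ball J poly_norm)"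
    using le by (rule bdd_aboveI2)
  \<comment> \<open>The far point depends on \<open>x\<close>; the supremum over \<open>x\<close> is
    taken only afterwards, so \<open>P\<close> need not attain its norm.\<close>
  have "norm (P x) + 1 \<le> farthest_dist poly_norm P (unit_ball J poly_norm)" if x: "norm x \<le> 1" for x
  proof -
    obtain Q where "Q \<in> unit_ball J poly_norm" "norm (P x) + 1 \<le> poly_norm (P - fscale sF (of_real 1) Q)"
      using exists_far_direction[OF assms(1) x nontrivial] zero_le_one by blast
    then show ?thesis
      unfolding farthest_dist_def using cSUP_upper[OF _ bdd, of Q] by simp
  qed
  then have "poly_norm P \<le> farthest_dist poly_norm P (unit_ball J poly_norm) - 1"
    by (intro poly_norm_le) (simp add: algebra_simps)
  then show "poly_norm P + 1 \<le> farthest_dist poly_norm P (unit_ball J poly_norm)" by simp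
qed

lemma farthest_set_eq_norm_attaining:
  assumes refl: "reflexive sE" and M: "M_ideal (fscale sF) X poly_norm J"
    and nontrivial: "\<exists>e::'e. e \<noteq> 0" "\<exists>f::'f. f \<noteq> 0"
  shows "farthest_set X poly_norm (unit_ball J poly_norm) = norm_attaining n sE sF"
proof
  show "farthest_set X poly_norm (unit_ball J poly_norm) \<subseteq> norm_attaining n sE sF"
    using norm_attaining_if_far[OF refl M] farthest_dist_eq[OF _ nontrivial]
    by (auto simp: farthest_set_def)
  show "norm_attaining n sE sF \<subseteq> farthest_set X poly_norm (unit_ball J poly_norm)"
  proof
    fix P assume "P \<in> norm_attaining n sE sF"
    then obtain x where P: "P \<in> X" and x: "norm x \<le> 1" "norm (P x) = poly_norm P"
      by (auto simp: norm_attaining_def)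
    obtain Q where Q: "Q \<in> unit_ball J poly_norm"
      "norm (P x) + 1 \<le> poly_norm (P - fscale sF (of_real 1) Q)"
      using exists_far_direction[OF P x(1) nontrivial] zero_le_one by blast
    then have "poly_norm P + 1 \<le> poly_norm (P - Q)" using x(2) by simp
    moreover have "poly_norm (P - Q) \<le> poly_norm P + 1"
      using P.N_diff_le[OF P, of Q] Q(1) by (auto simp: unit_ball_def hpoly_w_def)
    ultimately show "P \<in> farthest_set X poly_norm (unit_ball J poly_norm)"
      using P Q(1) farthest_dist_eq[OF P nontrivial] by (auto simp: farthest_set_def)
  qed
qed

section \<open>Polynomials for which 0 is not a best approximation from \<open>J\<close>\<close>

definition near_J :: "('e \<Rightarrow> 'f) set" where
  "near_J = {P \<in> X. \<exists>Q\<in>J. poly_norm (P - Q) < poly_norm P}"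

lemma openin_near_J: "openin P.mtopology near_J"
  unfolding P.openin_mtopology
proof (intro conjI allI impI)
  show "near_J \<subseteq> X" by (auto simp: near_J_def)
  fix P assume "P \<in> near_J"
  then obtain Q where P: "P \<in> X" and Q: "Q \<in> J" "Q \<in> X" "poly_norm (P - Q) < poly_norm P"
    by (auto simp: near_J_def hpoly_w_def)
  \<comment> \<open>Half of the gap suffices: a move by less than \<open>r\<close> raises the
    distance to \<open>Q\<close> and lowers the norm by less than \<open>r\<close> each.\<close>
  define r where "r = (poly_norm P - poly_norm (P - Q)) / 2"
  have "R \<in> near_J" if "R \<in> P.mball P r" for R
  proof -
    have R: "R \<in> X" "poly_norm (P - R) < r" using that by (auto simp: P.mem_mball)
    have "poly_norm (R - Q) \<le> poly_norm (R - P) + poly_norm (P - Q)"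
      using P.N_triangle[of "R - P" "P - Q"] P Q(2) R(1) P.diff_in by simp
    moreover have "poly_norm (R - P) = poly_norm (P - R)" using P R(1) by (rule P.N_commute[rotated])
    moreover have "poly_norm P \<le> poly_norm (P - R) + poly_norm R" using P R(1) by (rule P.N_triangle_diff)
    ultimately have "poly_norm (R - Q) < poly_norm R" using R(2) by (simp add: r_def field_simps)
    then show ?thesis using R(1) Q(1) by (auto simp: near_J_def)
  qed
  moreover have "r > 0" using Q(3) by (simp add: r_def)
  ultimately show "\<exists>r>0. P.mball P r \<subseteq> near_J" by blast
qed

lemma near_J_dense:
  assumes nontrivial: "\<exists>e::'e. e \<noteq> 0" "\<exists>f::'f. f \<noteq> 0"
    and J: "module.subspace (fscale sF) J" and P: "P \<in> X" and \<epsilon>: "\<epsilon> > 0"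
  shows "\<exists>R\<in>near_J. R \<in> P.mball P \<epsilon>"
proof -
  define t where "t = \<epsilon> / 2"
  have "t > 0" "t < \<epsilon>" using \<epsilon> by (simp_all add: t_def)
  have "poly_norm P - t < (SUP x\<in>cball 0 1. norm (P x))"
    using \<open>t > 0\<close> by (simp add: poly_norm_def)
  then obtain x where x: "norm x \<le> 1" "poly_norm P - t < norm (P x)"
    using hpoly_bounded[OF P] by (subst (asm) less_cSUP_iff) auto
  obtain Q where Q: "Q \<in> unit_ball J poly_norm"
    "norm (P x) + t \<le> poly_norm (P - fscale sF (of_real t) Q)"
    using exists_far_direction[OF P x(1) nontrivial] \<open>t > 0\<close> by (meson less_imp_le)
  define Q' where "Q' = fscale sF (of_real t) Q"
  have Q'_J: "- Q' \<in> J"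
    unfolding Q'_def using Q(1) J by (auto simp: unit_ball_def intro!: P.subspace_neg P.subspace_scale)
  have Q'_X: "Q' \<in> X" and Q_X: "Q \<in> X"
    using Q(1) unfolding Q'_def by (auto simp: unit_ball_def hpoly_w_def intro!: P.scale_in)
  \<comment> \<open>The approximant \<open>- Q'\<close> leads back to \<open>P\<close>. Since
    \<open>x\<close> norms \<open>P\<close> up to an error below t, the gain of t pushes the norm of
    \<open>P - Q'\<close> above that of \<open>P\<close>.\<close>
  have "poly_norm ((P - Q') - (- Q')) < poly_norm (P - Q')"
    using Q(2) x(2) by (simp add: Q'_def)
  then have "P - Q' \<in> near_J"
    unfolding near_J_def using P.diff_in[OF P Q'_X] Q'_J by blast
  moreover have "poly_norm Q' \<le> t"
    using Q(1) \<open>t > 0\<close> P.N_scale[OF Q_X, of "of_real t"] by (simp add: Q'_def unit_ball_def)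
  then have "P - Q' \<in> P.mball P \<epsilon>"
    using \<open>t < \<epsilon>\<close> P P.diff_in[OF P Q'_X] by (simp add: P.mem_mball)
  ultimately show ?thesis by blast
qed

end

theorem corollary1p14:
  fixes sE :: "'k::rc_field \<Rightarrow> 'e::banach \<Rightarrow> 'e"
    and sF :: "'k \<Rightarrow> 'f::banach \<Rightarrow> 'f"
    and n :: nat
  assumes "normed_space_over sE"
    and "normed_space_over sF"
    and "n \<ge> 1"
    and "reflexive sE"
    and "M_ideal (fscale sF) (hpoly n sE sF) poly_norm (hpoly_w n sE sF)"
  shows "farthest_set (hpoly n sE sF) poly_norm (unit_ball (hpoly_w n sE sF) poly_norm)
           = norm_attaining n sE sF
       \<and> nowhere_dense_in (norm_topology (hpoly n sE sF) poly_norm)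
           (hpoly n sE sF - farthest_set (hpoly n sE sF) poly_norm
                              (unit_ball (hpoly_w n sE sF) poly_norm))
       \<and> almost_remotal (hpoly n sE sF) poly_norm (unit_ball (hpoly_w n sE sF) poly_norm)"
proof -
  interpret hpoly_space sE sF n
    using assms(1-3) by (simp add: hpoly_space_def hpoly_space_axioms_def)
  let ?R = "farthest_set X poly_norm (unit_ball J poly_norm)"
  have J: "module.subspace (fscale sF) J" using assms(5) by (simp add: M_ideal_def)
  have "?R = norm_attaining n sE sF \<and>
    (\<exists>U\<subseteq>?R. openin P.mtopology U \<and> P.mtopology closure_of U = X)"
  \<comment> \<open>If one of the spaces is zero, the farthest distance is 0 instead of
    \<open>poly_norm P + 1\<close>. All polynomials vanish then, and the whole space serves as the
    dense open set.\<close>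
  proof (cases "(\<exists>e::'e. e \<noteq> 0) \<and> (\<exists>f::'f. f \<noteq> 0)")
    case True
    then have R: "?R = norm_attaining n sE sF"
      using farthest_set_eq_norm_attaining assms(4,5) by blast
    moreover have "near_J \<subseteq> ?R"
      using norm_attaining_if_near_J[OF assms(4,5)] by (auto simp: R near_J_def)
    moreover have "P.mtopology closure_of near_J = X"
      using near_J_dense True J by (fastforce simp: P.metric_closure_of simp del: P.in_mball)
    ultimately show ?thesis using openin_near_J by blast
  next
    case False
    have X: "P = 0" if "P \<in> X" for P
    proof
      fix x show "P x = 0 x" using False hpoly_at_zero[OF that] by (cases "x = 0") auto
    qed
    have "unit_ball J poly_norm = {0}"
      using X J P.subspace_0 by (auto simp: unit_ball_def hpoly_w_def)
    then have "?R = X" by (auto simp: farthest_set_def farthest_dist_def)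
    moreover have "X \<subseteq> norm_attaining n sE sF"
      using X norm_attainingI[of 0 0] P.zero_in by auto
    then have "norm_attaining n sE sF = X" by (auto simp: norm_attaining_def)
    moreover have "openin P.mtopology X" "P.mtopology closure_of X = X"
      using openin_topspace[of P.mtopology] closure_of_topspace[of P.mtopology] by auto
    ultimately show ?thesis by auto
  qed
  then obtain U where eq: "?R = norm_attaining n sE sF" and U: "U \<subseteq> ?R" "openin P.mtopology U"
    "P.mtopology closure_of U = X"
    by blast
  \<comment> \<open>The complement of the dense open set \<open>U\<close> is closed, contains the
    exceptional set and has empty interior. \<open>U\<close> is also the dense G-delta set that
    almost remotality asks for.\<close>
  have "P.mtopology closure_of (X - ?R) \<subseteq> X - U"
    using U(1,2) by (intro closure_of_minimal) (auto simp: closedin_def openin_subset)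
  then have "P.mtopology interior_of (P.mtopology closure_of (X - ?R)) \<subseteq> P.mtopology interior_of (X - U)"
    by (rule interior_of_mono)
  also have "\<dots> = {}"
    using interior_of_complement[of P.mtopology U] U(3) by simp
  finally have "nowhere_dense_in P.mtopology (X - ?R)"
    by (simp add: nowhere_dense_in_def)
  moreover have "almost_remotal X poly_norm (unit_ball J poly_norm)"
    unfolding almost_remotal_def P.norm_topology_eq using U open_imp_gdelta_in by blast
  ultimately show ?thesis using eq by (simp add: P.norm_topology_eq)
qed

end
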